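(* Let $X$ be the Hermitian curve $y^q+y=x^{q+1}$ over $\mathbb{F}_{q^2}$ (genus $g=q(q-1)/2$), let $P,Q$ be distinct rational points, and let $H$ be the intersection divisor of a line with $X$ (so $H\sim(q+1)P\sim(q+1)Q$). Then the set $\mathcal{D}_0(P,Q)$ consists of exactly $q+1$ pairwise inequivalent divisor classes, represented by the divisors $dH-dP-dQ$ for $d=0,1,\ldots,q$.
   Context: For a divisor $E$, $L(E)=\{f:(f)+E\geq 0\}\cup\{0\}$. For distinct rational points $P,Q$, the set of discrepancies $\mathcal{D}(P,Q)$ is the set of divisor classes $A$ with $L(A)\neq L(A-P)$ and $L(A-Q)=L(A-Q-P)$, and $\mathcal{D}_0(P,Q)=\mathcal{D}(P,Q)\cap\{iP+jQ:i,j\in\mathbb{Z}\}$. The canonical class of the Hermitian curve is $(q-2)H$. *)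

theory Defs
  imports "HOL-Computational_Algebra.Polynomial"
begin

definition is_subfield :: "'f::field set \<Rightarrow> bool" where
  "is_subfield S \<longleftrightarrow> 0 \<in> S \<and> 1 \<in> S \<and>
     (\<forall>a\<in>S. \<forall>b\<in>S. a + b \<in> S \<and> a * b \<in> S) \<and> (\<forall>a\<in>S. - a \<in> S \<and> inverse a \<in> S)"

text \<open>
  The whole type is the function field of the curve \<open>y\<^sup>q + y = x\<^sup>q\<^sup>+\<^sup>1\<close> over the finite
  field \<open>K\<close> with \<open>q\<^sup>2\<close> elements (so \<open>q\<close> is automatically a prime power).  As the polynomial
  \<open>Y\<^sup>q + Y - x\<^sup>q\<^sup>+\<^sup>1\<close> is irreducible over \<open>K(x)\<close>, the assumptions determine the field together
  with \<open>x\<close> and \<open>y\<close> up to isomorphism over \<open>K\<close>.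
\<close>

locale hermitian_curve =
  fixes q :: nat and K :: "'f::field set" and x y :: 'f
  assumes subfield_K: "is_subfield K"
    and finite_K: "finite K"
    and card_K: "card K = q\<^sup>2"
    and curve_eq: "y ^ q + y = x ^ (q + 1)"
    and x_transcendental: "\<And>p. set (coeffs p) \<subseteq> K \<Longrightarrow> poly p x = 0 \<Longrightarrow> p = 0"
    and generated: "\<And>S. is_subfield S \<Longrightarrow> K \<subseteq> S \<Longrightarrow> x \<in> S \<Longrightarrow> y \<in> S \<Longrightarrow> S = UNIV"

text \<open>
  The closed points of the smooth projective curve are the places of its function field.  A place
  is given by its normalized discrete valuation trivial on \<open>K\<close>.  The value \<open>v 0 = 0\<close> is a
  dummy (it stands for infinity), fixed only so that a place is represented by a single function.
\<close>

definition places :: "'f::field set \<Rightarrow> ('f \<Rightarrow> int) set" where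
  "places K = {v. v 0 = 0 \<and>
     (\<forall>f g. f \<noteq> 0 \<longrightarrow> g \<noteq> 0 \<longrightarrow> v (f * g) = v f + v g) \<and>
     (\<forall>f g. f \<noteq> 0 \<longrightarrow> g \<noteq> 0 \<longrightarrow> f + g \<noteq> 0 \<longrightarrow> min (v f) (v g) \<le> v (f + g)) \<and>
     (\<forall>a\<in>K. a \<noteq> 0 \<longrightarrow> v a = 0) \<and>
     (\<exists>t. t \<noteq> 0 \<and> v t = 1)}"

text \<open>Rational points are the places of degree one, i.e. with residue field \<open>K\<close>.\<close>

definition rational_points :: "'f::field set \<Rightarrow> ('f \<Rightarrow> int) set" where
  "rational_points K =
     {v \<in> places K. \<forall>f. f \<noteq> 0 \<longrightarrow> 0 \<le> v f \<longrightarrow> (\<exists>a\<in>K. f - a = 0 \<or> 0 < v (f - a))}"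

type_synonym 'f divisor = "('f \<Rightarrow> int) \<Rightarrow> int"

definition divisors :: "'f::field set \<Rightarrow> 'f divisor set" where
  "divisors K = {D. finite {v. D v \<noteq> 0} \<and> {v. D v \<noteq> 0} \<subseteq> places K}"

definition pt :: "('f \<Rightarrow> int) \<Rightarrow> 'f divisor" where
  "pt P = (\<lambda>v. if v = P then 1 else 0)"

definition principal :: "'f::field set \<Rightarrow> 'f \<Rightarrow> 'f divisor" where
  "principal K f = (\<lambda>v. if v \<in> places K then v f else 0)"

definition lin_equiv :: "'f::field set \<Rightarrow> ('f divisor \<times> 'f divisor) set" where
  "lin_equiv K = {(A, B). A \<in> divisors K \<and> B \<in> divisors K \<and>
     (\<exists>f. f \<noteq> 0 \<and> (\<forall>v. A v - B v = principal K f v))}"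

definition divisor_class :: "'f::field set \<Rightarrow> 'f divisor \<Rightarrow> 'f divisor set" where
  "divisor_class K A = lin_equiv K `` {A}"

definition L_space :: "'f::field set \<Rightarrow> 'f divisor \<Rightarrow> 'f set" where
  "L_space K E = {f. f \<noteq> 0 \<and> (\<forall>v. 0 \<le> principal K f v + E v)} \<union> {0}"

definition discrepancy ::
    "'f::field set \<Rightarrow> ('f \<Rightarrow> int) \<Rightarrow> ('f \<Rightarrow> int) \<Rightarrow> 'f divisor \<Rightarrow> bool" where
  "discrepancy K P Q A \<longleftrightarrow>
     L_space K A \<noteq> L_space K (\<lambda>v. A v - pt P v) \<and>
     L_space K (\<lambda>v. A v - pt Q v) = L_space K (\<lambda>v. A v - pt Q v - pt P v)"

text \<open>
  Being a discrepancy depends only on the divisor class, see \<open>discrepancy_lin_equiv\<close> below.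
\<close>

definition discrepancies ::
    "'f::field set \<Rightarrow> ('f \<Rightarrow> int) \<Rightarrow> ('f \<Rightarrow> int) \<Rightarrow> 'f divisor set set" where
  "discrepancies K P Q = {divisor_class K A | A. A \<in> divisors K \<and> discrepancy K P Q A}"

definition discrepancies0 ::
    "'f::field set \<Rightarrow> ('f \<Rightarrow> int) \<Rightarrow> ('f \<Rightarrow> int) \<Rightarrow> 'f divisor set set" where
  "discrepancies0 K P Q = discrepancies K P Q \<inter>
     {divisor_class K (\<lambda>v. i * pt P v + j * pt Q v) | i j. True}"

text \<open>
  Intersection divisor of the projective line \<open>aX + bY + cZ = 0\<close> with the curve, embedded in the
  plane by \<open>(x : y : 1)\<close>: at each place the linear form is divided by a coordinate of minimal
  valuation, which gives a local equation for the line.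
\<close>

definition line_divisor :: "'f::field set \<Rightarrow> 'f \<Rightarrow> 'f \<Rightarrow> 'f \<Rightarrow> 'f \<Rightarrow> 'f \<Rightarrow> 'f divisor" where
  "line_divisor K x y a b c =
     (\<lambda>v. if v \<in> places K then v (a * x + b * y + c) - Min {v x, v y, v 1} else 0)"

lemma place_mult: "v \<in> places K \<Longrightarrow> f \<noteq> 0 \<Longrightarrow> g \<noteq> 0 \<Longrightarrow> v (f * g) = v f + v g"
  by (simp add: places_def)

lemma place_one: "v \<in> places K \<Longrightarrow> v 1 = 0"
  using place_mult[of v K 1 1] by simp

lemma principal_mult: "f \<noteq> 0 \<Longrightarrow> g \<noteq> 0 \<Longrightarrow> principal K (f * g) v = principal K f v + principal K g v"
  by (simp add: principal_def place_mult)

lemma principal_one: "principal K 1 v = 0"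
  by (simp add: principal_def place_one)

lemma principal_inverse: "f \<noteq> 0 \<Longrightarrow> principal K (inverse f) v = - principal K f v"
  using principal_mult[of f "inverse f" K v] by (simp add: principal_one)

lemma equiv_lin_equiv: "equiv (divisors K) (lin_equiv K)"
proof (rule equivI)
  show "lin_equiv K \<subseteq> divisors K \<times> divisors K"
    by (auto simp: lin_equiv_def)
  show "refl_on (divisors K) (lin_equiv K)"
    by (auto simp: refl_on_def lin_equiv_def principal_one intro!: exI[of _ 1])
  show "sym (lin_equiv K)"
  proof (rule symI)
    fix A B assume "(A, B) \<in> lin_equiv K"
    then obtain f where "A \<in> divisors K" "B \<in> divisors K" "f \<noteq> 0"
      and f: "\<And>v. A v - B v = principal K f v" by (auto simp: lin_equiv_def)
    moreover have "B v - A v = principal K (inverse f) v" for v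
      using f[of v] \<open>f \<noteq> 0\<close> by (simp add: principal_inverse)
    ultimately show "(B, A) \<in> lin_equiv K"
      by (auto simp: lin_equiv_def intro!: exI[of _ "inverse f"])
  qed
  show "trans (lin_equiv K)"
  proof (rule transI)
    fix A B C assume "(A, B) \<in> lin_equiv K" "(B, C) \<in> lin_equiv K"
    then obtain f g where "A \<in> divisors K" "C \<in> divisors K" "f \<noteq> 0" "g \<noteq> 0"
      and f: "\<And>v. A v - B v = principal K f v" and g: "\<And>v. B v - C v = principal K g v"
      by (auto simp: lin_equiv_def)
    moreover have "A v - C v = principal K (f * g) v" for v
      using f[of v] g[of v] \<open>f \<noteq> 0\<close> \<open>g \<noteq> 0\<close> by (simp add: principal_mult)
    ultimately show "(A, C) \<in> lin_equiv K"
      by (auto simp: lin_equiv_def intro!: exI[of _ "f * g"])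
  qed
qed

lemma L_space_shift:
  assumes "f \<noteq> 0" "\<And>v. A v = B v + principal K f v"
  shows "L_space K B = (\<lambda>h. f * h) ` L_space K A"
proof (intro equalityI subsetI)
  fix h assume h: "h \<in> L_space K B"
  have "inverse f * h \<in> L_space K A"
    using h assms by (cases "h = 0") (auto simp: L_space_def principal_mult principal_inverse algebra_simps)
  moreover have "h = f * (inverse f * h)" using assms(1) by simp
  ultimately show "h \<in> (\<lambda>h. f * h) ` L_space K A" by blast
next
  fix h assume "h \<in> (\<lambda>h. f * h) ` L_space K A"
  then show "h \<in> L_space K B"
    using assms by (auto simp: L_space_def principal_mult algebra_simps)
qed

lemma discrepancy_lin_equiv:
  assumes "(A, B) \<in> lin_equiv K"
  shows "discrepancy K P Q A \<longleftrightarrow> discrepancy K P Q B"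
proof -
  obtain f where f: "f \<noteq> 0" "\<And>v. A v - B v = principal K f v"
    using assms by (auto simp: lin_equiv_def)
  have A: "A v = B v + principal K f v" for v
    using f(2)[of v] by simp
  have inj: "inj (\<lambda>h. f * h)" using f(1) by (simp add: inj_on_def)
  have "L_space K (\<lambda>v. B v - D v) = (\<lambda>h. f * h) ` L_space K (\<lambda>v. A v - D v)" for D
    by (rule L_space_shift[OF f(1)]) (simp add: A)
  from this[of "\<lambda>_. 0"] this[of "pt P"] this[of "pt Q"] this[of "\<lambda>v. pt Q v + pt P v"]
  show ?thesis
    unfolding discrepancy_def by (simp add: inj_image_eq_iff[OF inj] diff_diff_eq)
qed

end

theory Submission
  imports "HOL-Algebra.Algebraic_Closure_Type" Defs
begin

text \<open>
  Projective changes of coordinates over \<open>K\<close> put \<open>P\<close> at infinity and \<open>Q\<close> at the origin.  There the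
  monomials \<open>x\<^sup>i y\<^sup>j\<close> with \<open>0 \<le> i \<le> q\<close> and \<open>j\<close> an integer have pole order \<open>q i + (q + 1) j\<close> at \<open>P\<close>
  and order \<open>i + (q + 1) j\<close> at \<open>Q\<close>; both are injective in \<open>(i, j)\<close>.  They form a \<open>K\<close>-basis of the
  functions regular outside \<open>P\<close> and \<open>Q\<close>, hence \<open>a P + b Q\<close> is a discrepancy exactly if some monomial has
  precisely the pole orders \<open>a\<close> and \<open>b\<close>, and up to powers of \<open>y\<close> these are the \<open>q + 1\<close> divisors
  \<open>d (q P - Q)\<close>.

  The substance is that functions regular outside infinity are polynomials in \<open>x\<close> and \<open>y\<close>.  A function
  can be written \<open>(\<Sum>j<q. c j (x) y\<^sup>j) / h(x)\<close>.  Since the curve is unramified over the affine line, each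
  geometric point \<open>(\<alpha>, \<beta>)\<close> over a root \<open>\<alpha>\<close> of \<open>h\<close> carries a place, obtained by expanding in power series in
  \<open>x - \<alpha>\<close>, and regularity there gives \<open>(\<Sum>j<q. c j (\<alpha>) \<beta>\<^sup>j) = 0\<close>.  This polynomial of degree less than \<open>q\<close>
  vanishes at \<open>q\<close> points \<open>\<beta>\<close>, so all \<open>c j\<close> share the root \<open>\<alpha>\<close> with \<open>h\<close> and the fraction can be reduced.
\<close>

section \<open>Places\<close>

text \<open>One monomial decides whether a divisor is a discrepancy, because the values at P and Q
  are minima over the same set of monomials. If a function has exact pole order a at P, a single
  monomial attains it, and the order of that monomial at Q is at least that of the function. So L(A)
  \<noteq> L(A - P) can be tested on this monomial alone, and replacing A by A - Q makes the test
  fail just when the bound at Q was sharp. Neither the genus nor the Riemann-Roch theorem enters.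

  The coordinates move, not the points: the function field, K and the places stay fixed, and the new
  pair satisfies \<open>hermitian_curve\<close> again, so all results of the locale apply to it.
  Only H depends on the coordinates.

  Two facts usually taken for granted need arguments. Regularity says something only about places
  known to exist, so places must be constructed. And H must have finite support to be a divisor;
  this comes from a special feature of the Hermitian curve: a line over K meets it in K-rational
  points only, and K is finite.\<close>

lemma place_add_ge:
  "v \<in> places K \<Longrightarrow> f \<noteq> 0 \<Longrightarrow> g \<noteq> 0 \<Longrightarrow> f + g \<noteq> 0 \<Longrightarrow> min (v f) (v g) \<le> v (f + g)"
  by (simp add: places_def)

lemma place_const: "v \<in> places K \<Longrightarrow> a \<in> K \<Longrightarrow> v a = 0"
  by (cases "a = 0") (auto simp: places_def)

lemma place_zero: "v \<in> places K \<Longrightarrow> v 0 = 0"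
  by (simp add: places_def)

lemma place_power: "v \<in> places K \<Longrightarrow> f \<noteq> 0 \<Longrightarrow> v (f ^ n) = int n * v f"
  by (induction n) (auto simp: place_one place_mult algebra_simps)

lemma place_inverse: "v \<in> places K \<Longrightarrow> v (inverse f) = - v f"
  using place_mult[of v K f "inverse f"] by (cases "f = 0") (auto simp: place_one place_zero)

lemma place_divide: "v \<in> places K \<Longrightarrow> f \<noteq> 0 \<Longrightarrow> g \<noteq> 0 \<Longrightarrow> v (f / g) = v f - v g"
  by (simp add: divide_inverse place_mult place_inverse)

lemma place_power_int:
  assumes "v \<in> places K" "f \<noteq> 0"
  shows "v (f powi n) = n * v f"
  using assms by (simp add: power_int_def place_power place_inverse)

lemma place_uminus: "v \<in> places K \<Longrightarrow> v (- f) = v f"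
  using place_mult[of v K "-1" "-1"] place_mult[of v K "-1" f] place_one[of v K]
  by (cases "f = 0") auto

lemma place_add_distinct:
  assumes v: "v \<in> places K" and f: "f \<noteq> 0" and g: "g \<noteq> 0" and ne: "v f \<noteq> v g"
  shows "f + g \<noteq> 0 \<and> v (f + g) = min (v f) (v g)"
proof -
  have *: "f + g \<noteq> 0 \<and> v (f + g) = v f" if "f \<noteq> 0" "g \<noteq> 0" "v f < v g" for f g
  proof -
    have n0: "f + g \<noteq> 0"
    proof
      assume "f + g = 0"
      then have "f = - g" by (simp add: eq_neg_iff_add_eq_0)
      then show False using that place_uminus[OF v] by simp
    qed
    have "min (v (f + g)) (v (- g)) \<le> v (f + g + - g)"
      using n0 that by (intro place_add_ge[OF v]) auto
    then have "v (f + g) \<le> v f" using that place_uminus[OF v, of g] by auto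
    moreover have "min (v f) (v g) \<le> v (f + g)"
      using n0 that by (intro place_add_ge[OF v]) auto
    ultimately show ?thesis using that n0 by auto
  qed
  show ?thesis
    using *[OF f g] *[OF g f] ne by (cases "v f < v g") (auto simp: add.commute min_def)
qed

text \<open>The strict triangle inequality, iterated: terms of pairwise distinct values cannot
  cancel. This is the source of both the linear independence of monomials and the computation of
  values.\<close>

lemma place_sum_distinct:
  assumes v: "v \<in> places K" and "finite I" "I \<noteq> {}"
    and "\<And>i. i \<in> I \<Longrightarrow> e i \<noteq> 0" and "inj_on (\<lambda>i. v (e i)) I"
  shows "sum e I \<noteq> 0 \<and> v (sum e I) = Min ((\<lambda>i. v (e i)) ` I)"
  using assms(2-)
proof (induction I rule: finite_ne_induct)
  case (insert i I)
  then have IH: "sum e I \<noteq> 0" "v (sum e I) = Min ((\<lambda>i. v (e i)) ` I)" by auto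
  have "Min ((\<lambda>i. v (e i)) ` I) \<in> (\<lambda>i. v (e i)) ` I"
    using insert by (intro Min_in) auto
  then obtain j where "j \<in> I" "v (sum e I) = v (e j)" using IH by auto
  then have "v (e i) \<noteq> v (sum e I)"
    using insert.hyps insert.prems(2) by (auto simp: inj_on_def)
  then have "e i + sum e I \<noteq> 0 \<and> v (e i + sum e I) = min (v (e i)) (v (sum e I))"
    using insert.prems IH by (intro place_add_distinct[OF v]) auto
  then show ?case using insert IH by (simp add: Min_insert)
qed auto

text \<open>Membership in a power of the maximal ideal; the case \<open>f = 0\<close> compensates the dummy value \<open>v 0 = 0\<close>.\<close>

definition ord_ge :: "('f::field \<Rightarrow> int) \<Rightarrow> int \<Rightarrow> 'f \<Rightarrow> bool" where
  "ord_ge v n f \<longleftrightarrow> f = 0 \<or> n \<le> v f"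

lemma ord_ge_0 [simp]: "ord_ge v n 0"
  by (simp add: ord_ge_def)

lemma ord_ge_mono: "ord_ge v n f \<Longrightarrow> m \<le> n \<Longrightarrow> ord_ge v m f"
  by (auto simp: ord_ge_def)

lemma ord_ge_const: "v \<in> places K \<Longrightarrow> a \<in> K \<Longrightarrow> ord_ge v 0 a"
  by (simp add: ord_ge_def place_const)

lemma ord_ge_uminus: "v \<in> places K \<Longrightarrow> ord_ge v n (- f) \<longleftrightarrow> ord_ge v n f"
  by (simp add: ord_ge_def place_uminus)

lemma ord_ge_add: "v \<in> places K \<Longrightarrow> ord_ge v n f \<Longrightarrow> ord_ge v n g \<Longrightarrow> ord_ge v n (f + g)"
  using place_add_ge[of v K f g] by (cases "f = 0 \<or> g = 0 \<or> f + g = 0") (auto simp: ord_ge_def)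

lemma ord_ge_diff: "v \<in> places K \<Longrightarrow> ord_ge v n f \<Longrightarrow> ord_ge v n g \<Longrightarrow> ord_ge v n (f - g)"
  using ord_ge_add[of v K n f "- g"] by (simp add: ord_ge_uminus)

lemma ord_ge_mult: "v \<in> places K \<Longrightarrow> ord_ge v m f \<Longrightarrow> ord_ge v n g \<Longrightarrow> ord_ge v (m + n) (f * g)"
  by (cases "f = 0 \<or> g = 0") (auto simp: ord_ge_def place_mult)

lemma ord_ge_power:
  assumes "v \<in> places K" "ord_ge v m f" "0 \<le> m" "0 < n"
  shows "ord_ge v m (f ^ n)"
proof (cases "f = 0")
  case False
  then have "m \<le> v f" using assms by (simp add: ord_ge_def)
  moreover have "1 * v f \<le> int n * v f" using assms calculation by (intro mult_right_mono) auto
  ultimately show ?thesis using False assms by (simp add: ord_ge_def place_power)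
qed (use assms in \<open>simp add: zero_power\<close>)

text \<open>The elements of positive value form a prime ideal of the valuation ring.\<close>

lemma ord_ge_prod_1:
  assumes v: "v \<in> places K" and "finite I" and "ord_ge v 1 (prod e I)"
    and "\<And>i. i \<in> I \<Longrightarrow> ord_ge v 0 (e i)"
  shows "\<exists>i\<in>I. ord_ge v 1 (e i)"
  using assms(2-)
proof (induction I rule: finite_induct)
  case empty
  then show ?case using place_one[OF v] by (simp add: ord_ge_def)
next
  case (insert i I)
  show ?case
  proof (cases "ord_ge v 1 (e i)")
    case False
    then have "e i \<noteq> 0" "v (e i) = 0" using insert.prems(2)[of i] by (auto simp: ord_ge_def)
    then have "ord_ge v 1 (prod e I)"
      using insert.hyps insert.prems(1) place_mult[OF v, of "e i" "prod e I"]
      by (cases "prod e I = 0") (simp_all add: ord_ge_def)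
    then show ?thesis using insert by auto
  qed auto
qed

section \<open>Subfields and polynomials over them\<close>

lemma
  assumes "is_subfield S"
  shows subfield_0: "0 \<in> S" and subfield_1: "1 \<in> S"
    and subfield_add: "a \<in> S \<Longrightarrow> b \<in> S \<Longrightarrow> a + b \<in> S"
    and subfield_mult: "a \<in> S \<Longrightarrow> b \<in> S \<Longrightarrow> a * b \<in> S"
    and subfield_uminus: "a \<in> S \<Longrightarrow> - a \<in> S"
    and subfield_inverse: "a \<in> S \<Longrightarrow> inverse a \<in> S"
  using assms by (auto simp: is_subfield_def)

lemma subfield_diff: "is_subfield S \<Longrightarrow> a \<in> S \<Longrightarrow> b \<in> S \<Longrightarrow> a - b \<in> S"
  using subfield_add[of S a "- b"] by (simp add: subfield_uminus)

lemma subfield_divide: "is_subfield S \<Longrightarrow> a \<in> S \<Longrightarrow> b \<in> S \<Longrightarrow> a / b \<in> S"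
  by (simp add: divide_inverse subfield_mult subfield_inverse)

lemma subfield_power: "is_subfield S \<Longrightarrow> a \<in> S \<Longrightarrow> a ^ n \<in> S"
  by (induction n) (auto simp: subfield_1 subfield_mult)

lemma subfield_sum: "is_subfield S \<Longrightarrow> (\<And>i. i \<in> I \<Longrightarrow> e i \<in> S) \<Longrightarrow> sum e I \<in> S"
  by (induction I rule: infinite_finite_induct) (auto simp: subfield_0 subfield_add)

lemma subfield_of_nat: "is_subfield S \<Longrightarrow> of_nat n \<in> S"
  by (induction n) (auto simp: subfield_0 subfield_1 subfield_add)

definition poly_over :: "'f::field set \<Rightarrow> 'f poly set" where
  "poly_over K = {p. \<forall>i. coeff p i \<in> K}"

lemma poly_overD: "p \<in> poly_over K \<Longrightarrow> coeff p i \<in> K"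
  by (simp add: poly_over_def)

context
  fixes K :: "'f::field set"
  assumes K: "is_subfield K"
begin

lemma poly_over_iff_coeffs: "p \<in> poly_over K \<longleftrightarrow> set (coeffs p) \<subseteq> K"
proof -
  have "p \<in> poly_over K \<longleftrightarrow> range (coeff p) \<subseteq> K" by (auto simp: poly_over_def)
  then show ?thesis by (simp add: range_coeff subfield_0[OF K])
qed

lemma poly_over_0: "0 \<in> poly_over K"
  by (simp add: poly_over_def subfield_0[OF K])

lemma poly_over_pCons: "a \<in> K \<Longrightarrow> p \<in> poly_over K \<Longrightarrow> pCons a p \<in> poly_over K"
  by (auto simp: poly_over_def coeff_pCons split: nat.split)

lemma poly_over_1: "1 \<in> poly_over K"
  by (simp add: one_pCons poly_over_pCons poly_over_0 subfield_1[OF K])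

lemma poly_over_add: "p \<in> poly_over K \<Longrightarrow> r \<in> poly_over K \<Longrightarrow> p + r \<in> poly_over K"
  by (simp add: poly_over_def subfield_add[OF K])

lemma poly_over_diff: "p \<in> poly_over K \<Longrightarrow> r \<in> poly_over K \<Longrightarrow> p - r \<in> poly_over K"
  by (simp add: poly_over_def subfield_diff[OF K])

lemma poly_over_mult: "p \<in> poly_over K \<Longrightarrow> r \<in> poly_over K \<Longrightarrow> p * r \<in> poly_over K"
  by (auto simp: poly_over_def coeff_mult intro!: subfield_sum[OF K] subfield_mult[OF K])

lemma poly_over_monom: "a \<in> K \<Longrightarrow> monom a n \<in> poly_over K"
  by (simp add: poly_over_def subfield_0[OF K])

lemma poly_over_sum: "(\<And>i. i \<in> I \<Longrightarrow> e i \<in> poly_over K) \<Longrightarrow> sum e I \<in> poly_over K"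
  by (induction I rule: infinite_finite_induct) (auto simp: poly_over_0 poly_over_add)

text \<open>\<open>K\<close> is a subset of the type, so division with remainder must be seen to
  keep the coefficients in \<open>K\<close>. It serves to show that the minimal polynomial over
  \<open>K\<close> of a geometric root divides every polynomial over \<open>K\<close> with that
  root.\<close>

lemma poly_over_division:
  assumes "m \<in> poly_over K" "m \<noteq> 0" "p \<in> poly_over K"
  obtains d r where "d \<in> poly_over K" "r \<in> poly_over K" "p = d * m + r" "r = 0 \<or> degree r < degree m"
proof -
  have "\<exists>d\<in>poly_over K. \<exists>r\<in>poly_over K. p = d * m + r \<and> (r = 0 \<or> degree r < degree m)"
    using assms(3)
  proof (induction "degree p" arbitrary: p rule: less_induct)
    case less
    show ?case
    proof (cases "p = 0 \<or> degree p < degree m")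
      case True
      then show ?thesis using less.prems by (intro bexI[of _ 0] bexI[of _ p]) (auto simp: poly_over_0)
    next
      case False
      define c where "c = monom (lead_coeff p / lead_coeff m) (degree p - degree m)"
      have c: "c \<in> poly_over K"
        unfolding c_def using assms less.prems
        by (intro poly_over_monom subfield_divide[OF K]) (auto simp: poly_overD)
      have c0: "c \<noteq> 0" using False assms by (simp add: c_def)
      have lc: "lead_coeff (c * m) = lead_coeff p"
        using assms False by (simp add: c_def lead_coeff_mult lead_coeff_monom degree_monom_eq)
      have dg: "degree (c * m) = degree p"
        using c0 assms False by (simp add: degree_mult_eq) (simp add: c_def degree_monom_eq)
      have pc: "p - c * m \<in> poly_over K" using less.prems c assms by (simp add: poly_over_diff poly_over_mult)
      show ?thesis
      proof (cases "p - c * m = 0")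
        case True
        then show ?thesis using c by (intro bexI[of _ c] bexI[of _ 0]) (auto simp: poly_over_0)
      next
        case ne: False
        have "degree (p - c * m) \<le> degree p"
          using dg degree_diff_le[of p "degree p" "c * m"] by simp
        moreover have "coeff (p - c * m) (degree p) = 0" using lc dg by simp
        ultimately have "degree (p - c * m) < degree p"
          using ne by (metis le_less leading_coeff_0_iff)
        from less.hyps[OF this pc] obtain d r where dr: "d \<in> poly_over K" "r \<in> poly_over K"
          "p - c * m = d * m + r" "r = 0 \<or> degree r < degree m" by blast
        have "p = (c + d) * m + r" using dr(3) by (simp add: algebra_simps)
        then show ?thesis using dr c by (intro bexI[of _ "c + d"] bexI[of _ r]) (auto simp: poly_over_add)
      qed
    qed
  qed
  then show ?thesis using that by blast
qed

end

text \<open>A root is split off; as the derivative does not vanish there, it is not a root of the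
  quotient and counts exactly once.\<close>

lemma card_roots_separable:
  fixes p :: "'a::alg_closed_field poly"
  assumes "p \<noteq> 0" "\<And>a. poly p a = 0 \<Longrightarrow> poly (pderiv p) a \<noteq> 0"
  shows "card {a. poly p a = 0} = degree p"
  using assms
proof (induction "degree p" arbitrary: p)
  case 0
  then obtain c where "p = [:c:]" by (metis degree_0_id)
  then show ?case using 0 by simp
next
  case (Suc n)
  then obtain a where a: "poly p a = 0" using alg_closed_imp_poly_has_root[of p] by auto
  then obtain r where r: "p = [:- a, 1:] * r" by (metis dvdE poly_eq_0_iff_dvd)
  have r0: "r \<noteq> 0" using r Suc.prems by auto
  have deg: "degree p = Suc (degree r)" unfolding r using r0 by (subst degree_mult_eq) auto
  have pd: "poly (pderiv p) b = poly r b + (b - a) * poly (pderiv r) b" for b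
    unfolding r pderiv_mult by (simp add: pderiv_pCons algebra_simps)
  have ra: "poly r a \<noteq> 0" using Suc.prems(2)[OF a] pd[of a] by simp
  have "card {b. poly r b = 0} = degree r"
  proof (rule Suc.hyps(1))
    show "n = degree r" using deg Suc.hyps by simp
    fix b assume b: "poly r b = 0"
    then have "poly p b = 0" by (simp add: r)
    then show "poly (pderiv r) b \<noteq> 0" using Suc.prems(2)[of b] pd[of b] b by auto
  qed (rule r0)
  moreover have "{b. poly p b = 0} = insert a {b. poly r b = 0}" unfolding r by auto
  ultimately show ?case using deg ra poly_roots_finite[OF r0] by simp
qed

section \<open>Finite subfields\<close>

lemma CHAR_finite_subfield:
  fixes K :: "'f::field set"
  assumes K: "is_subfield K" and fin: "finite K"
  shows "prime CHAR('f)"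
proof -
  have "range (of_nat :: nat \<Rightarrow> 'f) \<subseteq> K" using subfield_of_nat[OF K] by auto
  then have "\<not> inj (of_nat :: nat \<Rightarrow> 'f)" using fin finite_subset finite_imageD infinite_UNIV_nat by blast
  then obtain m n :: nat where "m \<noteq> n" "of_nat m = (of_nat n :: 'f)" by (auto simp: inj_on_def)
  then obtain m n :: nat where mn: "m < n" "of_nat m = (of_nat n :: 'f)" by (metis nat_neq_iff)
  then have "of_nat (n - m) = (0 :: 'f)" by (simp add: of_nat_diff)
  then have "CHAR('f) > 0" using mn by (auto simp: CHAR_pos_iff intro!: exI[of _ "n - m"])
  then show ?thesis by (rule prime_CHAR_semidom)
qed

text \<open>A dimension count over the prime field without bases. Among the additively closed
  subsets of \<open>K\<close> that contain 0 and have \<open>p\<close>-power size, a largest one is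
  all of \<open>K\<close>: an element \<open>a\<close> outside it would give \<open>p\<close>
  disjoint translates by multiples of \<open>a\<close>, again such a set. The aim is that
  \<open>q\<close> is a power of the characteristic, so that \<open>q\<close>-th powers are
  additive.\<close>

lemma card_finite_subfield:
  fixes K :: "'f::field set"
  assumes K: "is_subfield K" and fin: "finite K"
  shows "\<exists>n. card K = CHAR('f) ^ n"
proof -
  define p where "p = CHAR('f)"
  have p: "prime p" using CHAR_finite_subfield[OF assms] by (simp add: p_def)
  define S where "S = {V. V \<subseteq> K \<and> 0 \<in> V \<and> (\<forall>a\<in>V. \<forall>b\<in>V. a + b \<in> V) \<and> (\<exists>n. card V = p ^ n)}"
  have finS: "finite S" using fin by (auto simp: S_def intro: finite_subset[of _ "Pow K"])
  have S0: "{0} \<in> S" by (auto simp: S_def subfield_0[OF K] intro: exI[of _ 0])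
  have "Max (card ` S) \<in> card ` S" using finS S0 by (intro Max_in) auto
  then obtain V where V: "V \<in> S" and mV: "Max (card ` S) = card V" by auto
  have max: "card W \<le> card V" if "W \<in> S" for W
    using that finS by (auto simp flip: mV intro!: Max_ge)
  have V_add: "a + b \<in> V" if "a \<in> V" "b \<in> V" for a b using V that by (auto simp: S_def)
  have V0: "0 \<in> V" and VK: "V \<subseteq> K" using V by (auto simp: S_def)
  have finV: "finite V" using VK fin finite_subset by blast
  have V_nat: "of_nat n * a \<in> V" if "a \<in> V" for n a
    using that by (induction n) (auto simp: V0 distrib_right intro!: V_add)
  \<comment> \<open>Since -1 is the multiple \<open>p - 1\<close> of 1, closure under addition
    already gives closure under subtraction.\<close>
  have "of_nat (p - 1) + 1 = (of_nat p :: 'f)"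
    using prime_gt_0_nat[OF p] by (metis Suc_diff_1 of_nat_Suc add.commute)
  then have neg1: "of_nat (p - 1) = (-1 :: 'f)"
    by (simp add: p_def eq_neg_iff_add_eq_0)
  have V_diff: "a - b \<in> V" if "a \<in> V" "b \<in> V" for a b
    using V_add[OF that(1) V_nat[OF that(2), of "p - 1"]] neg1 by simp
  have "V = K"
  proof (rule ccontr)
    assume "V \<noteq> K"
    then obtain a where a: "a \<in> K" "a \<notin> V" using VK by auto
    define g where "g = (\<lambda>(i::nat, u). of_nat i * a + u)"
    have neq: "of_nat i * a + u \<noteq> of_nat j * a + w" if "i < j" "j < p" "u \<in> V" "w \<in> V" for i j u w
    proof
      assume eq: "of_nat i * a + u = of_nat j * a + w"
      have "of_nat (j - i) * a = u - w"
        using eq that(1) by (simp add: of_nat_diff left_diff_distrib diff_eq_eq) (simp add: algebra_simps)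
      then have kV: "of_nat (j - i) * a \<in> V" using V_diff[OF that(3,4)] by simp
      \<comment> \<open>The difference \<open>j - i\<close> is invertible modulo \<open>p\<close>,
        so a multiple of \<open>a\<close> lying in \<open>V\<close> would bring \<open>a\<close>
        itself into \<open>V\<close>.\<close>
      have "coprime (j - i) p"
        using p that by (metis coprime_commute prime_imp_coprime nat_dvd_not_less zero_less_diff
            less_imp_diff_less)
      moreover have "j - i \<noteq> 0" using that(1) by simp
      ultimately obtain l m where "(j - i) * l = p * m + 1"
        using bezout_nat[of "j - i" p] by auto
      then have "of_nat ((j - i) * l) = (of_nat (p * m + 1) :: 'f)" by simp
      then have "of_nat (j - i) * of_nat l = (1 :: 'f)" by (simp add: p_def)
      then have "of_nat l * (of_nat (j - i) * a) = a" by (metis mult.assoc mult.commute mult_1)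
      then show False using V_nat[OF kV, of l] a(2) by metis
    qed
    have inj: "inj_on g ({..<p} \<times> V)"
    proof (rule inj_onI, clarify)
      fix i u j w assume *: "i < p" "u \<in> V" "j < p" "w \<in> V" "g (i, u) = g (j, w)"
      then have "i = j" using neq[of i j u w] neq[of j i w u] by (cases i j rule: linorder_cases) (auto simp: g_def)
      then show "i = j \<and> u = w" using * by (simp add: g_def)
    qed
    have g_any: "of_nat i * a + u \<in> g ` ({..<p} \<times> V)" if "u \<in> V" for i u
    proof -
      have "of_nat i = (of_nat (p * (i div p) + i mod p) :: 'f)" by simp
      also have "\<dots> = of_nat (i mod p)" unfolding of_nat_add of_nat_mult by (simp add: p_def)
      finally have "of_nat i * a + u = g (i mod p, u)" by (simp add: g_def)
      then show ?thesis using that p by (simp add: prime_gt_0_nat)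
    qed
    have "g ` ({..<p} \<times> V) \<in> S"
      unfolding S_def
    proof (intro CollectI conjI ballI)
      show "g ` ({..<p} \<times> V) \<subseteq> K"
        using VK a by (auto simp: g_def intro!: subfield_add[OF K] subfield_mult[OF K] subfield_of_nat[OF K])
      show "0 \<in> g ` ({..<p} \<times> V)" using g_any[OF V0, of 0] by simp
      fix b c assume "b \<in> g ` ({..<p} \<times> V)" "c \<in> g ` ({..<p} \<times> V)"
      then obtain i u j w where "u \<in> V" "w \<in> V" "b = of_nat i * a + u" "c = of_nat j * a + w"
        by (auto simp: g_def)
      then show "b + c \<in> g ` ({..<p} \<times> V)"
        using g_any[OF V_add, of u w "i + j"] by (simp add: algebra_simps)
    next
      obtain n where "card V = p ^ n" using V by (auto simp: S_def)
      then have "card (g ` ({..<p} \<times> V)) = p ^ Suc n"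
        using inj by (simp add: card_image card_cartesian_product)
      then show "\<exists>n. card (g ` ({..<p} \<times> V)) = p ^ n" by blast
    qed
    from max[OF this] have "p * card V \<le> card V" using inj by (simp add: card_image card_cartesian_product)
    moreover have "card V > 0" using V0 finV by (auto simp: card_gt_0_iff)
    ultimately show False using prime_gt_1_nat[OF p] by simp
  qed
  then show ?thesis using V by (auto simp: S_def p_def)
qed

text \<open>Multiplication by a nonzero \<open>a\<close> permutes the nonzero elements, so it does
  not change their product.\<close>

lemma finite_subfield_power_card:
  fixes K :: "'f::field set"
  assumes K: "is_subfield K" and fin: "finite K" and a: "a \<in> K"
  shows "a ^ card K = a"
proof (cases "a = 0")
  case False
  have cK: "card K > 0" using a fin by (auto simp: card_gt_0_iff)
  have c: "card (K - {0}) = card K - 1" using fin subfield_0[OF K] by simp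
  have "(\<Prod>b\<in>K-{0}. a * b) = (\<Prod>b\<in>K-{0}. b)"
    by (rule prod.reindex_bij_witness[of _ "\<lambda>b. b / a" "\<lambda>b. a * b"])
       (use False a in \<open>auto intro: subfield_divide[OF K] subfield_mult[OF K]\<close>)
  then have "a ^ (card K - 1) * \<Prod>(K-{0}) = \<Prod>(K-{0})"
    by (simp add: prod.distrib c)
  moreover have "\<Prod>(K-{0}) \<noteq> 0" using fin by simp
  ultimately have "a ^ (card K - 1) = 1" by simp
  then have "a ^ Suc (card K - 1) = a" by simp
  then show ?thesis using cK by simp
next
  case True
  have "card K > 0" using a fin by (auto simp: card_gt_0_iff)
  then show ?thesis using True by (simp add: zero_power)
qed

text \<open>Both sides are monic of degree \<open>card K\<close> in \<open>z\<close> and vanish on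
  \<open>K\<close>; a nonzero difference would have more roots than its degree allows.\<close>

lemma finite_subfield_prod_diff:
  fixes K :: "'f::field set"
  assumes K: "is_subfield K" and fin: "finite K"
  shows "(\<Prod>a\<in>K. z - a) = z ^ card K - z"
proof -
  define n where "n = card K"
  have "card {0, 1 :: 'f} \<le> card K"
    using fin K by (intro card_mono) (auto simp: subfield_0 subfield_1)
  then have n: "n \<ge> 2" by (simp add: n_def)
  define r where "r = monom 1 n - monom (1::'f) 1"
  define s where "s = (\<Prod>a\<in>K. [:- a, 1:])"
  have ds: "degree s = n" unfolding s_def n_def
    by (subst degree_prod_eq_sum_degree) auto
  have ls: "lead_coeff s = 1" unfolding s_def by (simp add: lead_coeff_prod)
  have dr: "degree r \<le> n" unfolding r_def using n
    by (intro degree_diff_le) (auto simp: degree_monom_eq)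
  have lr: "coeff r n = 1" unfolding r_def using n by simp
  have "r = s"
  proof (rule ccontr)
    assume ne: "r \<noteq> s"
    have "degree (r - s) \<le> n" using degree_diff_le[of r n s] ds dr by simp
    moreover have "coeff (r - s) n = 0" using ls lr ds by simp
    ultimately have "degree (r - s) < n"
      using ne by (metis le_less leading_coeff_0_iff right_minus_eq)
    moreover have "K \<subseteq> {a. poly (r - s) a = 0}"
    proof
      fix a assume a: "a \<in> K"
      then have "poly s a = 0" unfolding s_def poly_prod using fin by (intro prod_zero) auto
      then show "a \<in> {a. poly (r - s) a = 0}"
        using finite_subfield_power_card[OF K fin a] by (simp add: r_def poly_monom n_def)
    qed
    then have "n \<le> card {a. poly (r - s) a = 0}"
      unfolding n_def using ne by (intro card_mono poly_roots_finite) auto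
    moreover have "card {a. poly (r - s) a = 0} \<le> degree (r - s)"
      using ne by (intro card_poly_roots_bound) auto
    ultimately show False by simp
  qed
  then have "poly r z = poly s z" by simp
  then show ?thesis by (simp add: r_def s_def poly_prod poly_monom n_def)
qed

section \<open>Normal forms in the coordinate ring\<close>

text \<open>
  A family \<open>c\<close> of polynomials stands for the element \<open>\<Sum>j<q. c j (\<xi>) \<eta>\<^sup>j\<close>.  Products are computed on
  families, using \<open>\<eta>\<^sup>q = \<xi>\<^sup>q\<^sup>+\<^sup>1 - \<eta>\<close>, so that they can be transported to any other solution
  \<open>(\<xi>, \<eta>)\<close> of the curve equation.
\<close>

definition nf_mult_y :: "nat \<Rightarrow> (nat \<Rightarrow> 'f::field poly) \<Rightarrow> nat \<Rightarrow> 'f poly" where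
  "nf_mult_y q c = (\<lambda>j. if j = 0 then monom 1 (q + 1) * c (q - 1)
     else if j = 1 then c 0 - c (q - 1) else c (j - 1))"

definition nf_mult :: "nat \<Rightarrow> (nat \<Rightarrow> 'f::field poly) \<Rightarrow> (nat \<Rightarrow> 'f poly) \<Rightarrow> nat \<Rightarrow> 'f poly" where
  "nf_mult q c d = (\<lambda>j. \<Sum>k<q. d k * (nf_mult_y q ^^ k) c j)"

text \<open>The target ring is left open because three solutions of the curve equation are compared:
  \<open>(x, y)\<close> in the function field, a geometric point over the algebraic closure, and a
  power series point reducing to it.\<close>

locale curve_point =
  fixes \<iota> :: "'f::field \<Rightarrow> 'r::comm_ring_1" and q :: nat and \<xi> \<eta> :: 'r
  assumes hom_0: "\<iota> 0 = 0" and hom_1: "\<iota> 1 = 1"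
    and hom_add: "\<iota> (a + b) = \<iota> a + \<iota> b" and hom_mult: "\<iota> (a * b) = \<iota> a * \<iota> b"
    and q_ge_2: "q \<ge> 2" and curve: "\<eta> ^ q + \<eta> = \<xi> ^ (q + 1)"
begin

definition eval_poly :: "'f poly \<Rightarrow> 'r" where
  "eval_poly p = poly (map_poly \<iota> p) \<xi>"

definition eval :: "(nat \<Rightarrow> 'f poly) \<Rightarrow> 'r" where
  "eval c = (\<Sum>j<q. eval_poly (c j) * \<eta> ^ j)"

lemma eval_poly_0 [simp]: "eval_poly 0 = 0"
  by (simp add: eval_poly_def)

lemma eval_poly_pCons: "eval_poly (pCons a p) = \<iota> a + \<xi> * eval_poly p"
  by (simp add: eval_poly_def map_poly_pCons hom_0)

lemma eval_poly_add: "eval_poly (p + r) = eval_poly p + eval_poly r"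
  by (induction p r rule: poly_induct2) (auto simp: eval_poly_pCons hom_add algebra_simps)

lemma eval_poly_uminus: "eval_poly (- p) = - eval_poly p"
  using eval_poly_add[of p "- p"] by (simp add: eq_neg_iff_add_eq_0 add.commute)

lemma eval_poly_diff: "eval_poly (p - r) = eval_poly p - eval_poly r"
  using eval_poly_add[of p "- r"] by (simp add: eval_poly_uminus)

lemma eval_poly_smult: "eval_poly (smult a p) = \<iota> a * eval_poly p"
  by (induction p) (auto simp: eval_poly_pCons hom_mult algebra_simps)

lemma eval_poly_mult: "eval_poly (p * r) = eval_poly p * eval_poly r"
  by (induction p) (auto simp: eval_poly_pCons eval_poly_add eval_poly_smult hom_0 algebra_simps)

lemma eval_poly_monom: "eval_poly (monom a n) = \<iota> a * \<xi> ^ n"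
  by (induction n) (auto simp: monom_0 monom_Suc eval_poly_pCons hom_0 algebra_simps)

lemma eval_poly_sum: "eval_poly (sum e I) = (\<Sum>i\<in>I. eval_poly (e i))"
  by (induction I rule: infinite_finite_induct) (auto simp: eval_poly_add)

lemma eval_add: "eval (\<lambda>j. c j + d j) = eval c + eval d"
  by (simp add: eval_def eval_poly_add distrib_right sum.distrib)

lemma eval_diff: "eval (\<lambda>j. c j - d j) = eval c - eval d"
  by (simp add: eval_def eval_poly_diff left_diff_distrib sum_subtractf)

lemma eval_smult: "eval (\<lambda>j. p * c j) = eval_poly p * eval c"
  by (simp add: eval_def eval_poly_mult sum_distrib_left mult.assoc)

lemma eval_sum: "eval (\<lambda>j. \<Sum>i\<in>I. e i j) = (\<Sum>i\<in>I. eval (e i))"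
  by (simp add: eval_def eval_poly_sum sum_distrib_right sum.swap[of _ I])

lemma eval_single: "k < q \<Longrightarrow> eval (\<lambda>j. if j = k then p else 0) = eval_poly p * \<eta> ^ k"
  by (simp add: eval_def if_distrib[of eval_poly] if_distrib[of "\<lambda>t. t * _"] sum.delta cong: if_cong)

lemma eval_mult_y: "eval (nf_mult_y q c) = \<eta> * eval c"
proof -
  \<comment> \<open>Indices 0 and 1 are split off because the relation sends the overflowing top
    coefficient to exactly these two.\<close>
  obtain m where q: "q = Suc (Suc m)"
    using q_ge_2 by (metis add_2_eq_Suc le_Suc_ex)
  let ?e = "\<lambda>j. eval_poly (c j)"
  have yq: "\<eta> ^ q = \<xi> ^ (q + 1) - \<eta>" using curve by (simp add: eq_diff_eq)
  have "eval (nf_mult_y q c) = (\<Sum>j<Suc (Suc m). eval_poly (nf_mult_y q c j) * \<eta> ^ j)"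
    unfolding eval_def by (simp only: q)
  also have "\<dots> = \<xi> ^ (q + 1) * ?e (Suc m) + (?e 0 - ?e (Suc m)) * \<eta>
      + (\<Sum>j<m. ?e (Suc j) * \<eta> ^ Suc (Suc j))"
    by (subst sum.lessThan_Suc_shift, subst sum.lessThan_Suc_shift)
       (simp add: nf_mult_y_def q eval_poly_mult eval_poly_monom hom_1 eval_poly_diff add_ac)
  also have "\<dots> = ?e 0 * \<eta> + (\<Sum>j<m. ?e (Suc j) * \<eta> ^ Suc (Suc j)) + ?e (Suc m) * \<eta> ^ q"
    by (simp add: yq algebra_simps)
  also have "\<dots> = \<eta> * (\<Sum>j<Suc (Suc m). ?e j * \<eta> ^ j)"
    by (subst sum.lessThan_Suc_shift) (simp add: q sum_distrib_left algebra_simps)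
  finally show ?thesis unfolding eval_def by (simp only: q)
qed

lemma eval_mult: "eval (nf_mult q c d) = eval c * eval d"
proof -
  have *: "eval ((nf_mult_y q ^^ k) c) = \<eta> ^ k * eval c" for k
    by (induction k) (auto simp: eval_mult_y mult.assoc)
  have "eval (nf_mult q c d) = (\<Sum>k<q. eval_poly (d k) * (\<eta> ^ k * eval c))"
    unfolding nf_mult_def by (simp add: eval_sum eval_smult *)
  also have "\<dots> = eval c * eval d" by (simp add: eval_def[of d] sum_distrib_left mult_ac)
  finally show ?thesis .
qed

end

lemma nf_mult_over:
  assumes K: "is_subfield K" and c: "\<And>j. c j \<in> poly_over K" and d: "\<And>j. d j \<in> poly_over K"
  shows "nf_mult q c d j \<in> poly_over K"
proof -
  have "(nf_mult_y q ^^ k) c j \<in> poly_over K" for k j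
  proof (induction k arbitrary: j)
    case (Suc k)
    then show ?case
      by (auto simp: nf_mult_y_def intro!: poly_over_mult[OF K] poly_over_diff[OF K] poly_over_monom[OF K] subfield_1[OF K])
  qed (use c in auto)
  then show ?thesis
    unfolding nf_mult_def using d by (intro poly_over_sum[OF K] poly_over_mult[OF K]) auto
qed

text \<open>Every injectivity claim for exponents reduces to this: two indices in a range of length
  \<open>q + 1\<close> that agree modulo \<open>q + 1\<close> are equal.\<close>

lemma small_multiple_eq_0:
  fixes m d :: int
  assumes "(int q + 1) * m = d" "\<bar>d\<bar> \<le> int q"
  shows "m = 0"
proof (rule ccontr)
  assume "m \<noteq> 0"
  then have "int q + 1 \<le> (int q + 1) * \<bar>m\<bar>" by simp
  also have "\<dots> = \<bar>d\<bar>" using assms(1) by (simp add: abs_mult flip: assms(1))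
  finally show False using assms(2) by simp
qed

section \<open>Frobenius and the coordinate ring of the affine curve\<close>

context hermitian_curve
begin

lemma q_ge_2: "q \<ge> 2"
proof -
  have "card {0, 1 :: 'f} \<le> card K"
    using finite_K subfield_K by (intro card_mono) (auto simp: subfield_0 subfield_1)
  then have "2 \<le> q\<^sup>2" by (simp add: card_K)
  then show ?thesis by (cases "q = 0 \<or> q = 1") auto
qed

lemma prime_CHAR: "prime CHAR('f)"
  using CHAR_finite_subfield[OF subfield_K finite_K] .

lemma q_eq_CHAR_power: "\<exists>e. q = CHAR('f) ^ e"
proof -
  obtain n where "q\<^sup>2 = CHAR('f) ^ n" using card_finite_subfield[OF subfield_K finite_K] card_K by auto
  then have "q dvd CHAR('f) ^ n" by (metis dvd_power zero_less_numeral dvd_triv_left power2_eq_square)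
  then show ?thesis using prime_CHAR by (auto simp: divides_primepow_nat)
qed

text \<open>Stated for any commutative ring of the same characteristic, as it is applied in the
  function field, in its algebraic closure and in power series over the latter.\<close>

lemma frobenius_add:
  fixes a b :: "'r::comm_ring_1"
  assumes "CHAR('r) = CHAR('f)"
  shows "(a + b) ^ q ^ n = a ^ q ^ n + b ^ q ^ n"
proof -
  obtain e where "q = CHAR('f) ^ e" using q_eq_CHAR_power ..
  then have "q ^ n = CHAR('r) ^ (e * n)" by (simp add: assms power_mult)
  then show ?thesis using freshmans_dream' prime_CHAR assms by metis
qed

lemma frobenius_diff:
  fixes a b :: "'r::comm_ring_1"
  assumes "CHAR('r) = CHAR('f)"
  shows "(a - b) ^ q ^ n = a ^ q ^ n - b ^ q ^ n"
  using frobenius_add[OF assms, of "a - b" b n] by (simp add: eq_diff_eq)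

lemma frob_add: "(a + b :: 'f) ^ q = a ^ q + b ^ q"
  using frobenius_add[of a b 1] by simp

lemma frob_diff: "(a - b :: 'f) ^ q = a ^ q - b ^ q"
  using frobenius_diff[of a b 1] by simp

lemma const_power_q2: "a \<in> K \<Longrightarrow> (a ^ q) ^ q = a"
  using finite_subfield_power_card[OF subfield_K finite_K, of a]
  by (simp add: card_K power2_eq_square power_mult)

lemma x_not_root: "p \<in> poly_over K \<Longrightarrow> p \<noteq> 0 \<Longrightarrow> poly p x \<noteq> 0"
  using x_transcendental by (auto simp: poly_over_iff_coeffs[OF subfield_K])

lemma x_minus_const_neq_0: "a \<in> K \<Longrightarrow> x - a \<noteq> 0"
  using x_not_root[of "[:- a, 1:]"]
  by (auto simp: poly_over_pCons poly_over_0 subfield_K subfield_uminus subfield_1)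

lemma x_neq_0: "x \<noteq> 0"
  using x_minus_const_neq_0[of 0] by (simp add: subfield_0 subfield_K)

lemma y_neq_0: "y \<noteq> 0"
  using curve_eq x_neq_0 q_ge_2 by (auto simp: zero_power)

sublocale self: curve_point "\<lambda>a. a" q x y
  using q_ge_2 curve_eq by unfold_locales auto

lemma eval_poly_self: "self.eval_poly p = poly p x"
  by (simp add: self.eval_poly_def map_poly_idI)

definition coord_ring :: "'f set" where
  "coord_ring = {self.eval c | c. \<forall>j. c j \<in> poly_over K}"

lemma coord_ring_add: "f \<in> coord_ring \<Longrightarrow> g \<in> coord_ring \<Longrightarrow> f + g \<in> coord_ring"
  unfolding coord_ring_def
  by clarify (rule exI, rule conjI, rule self.eval_add[symmetric], simp add: poly_over_add subfield_K)

lemma coord_ring_diff: "f \<in> coord_ring \<Longrightarrow> g \<in> coord_ring \<Longrightarrow> f - g \<in> coord_ring"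
  unfolding coord_ring_def
  by clarify (rule exI, rule conjI, rule self.eval_diff[symmetric], simp add: poly_over_diff subfield_K)

lemma coord_ring_mult: "f \<in> coord_ring \<Longrightarrow> g \<in> coord_ring \<Longrightarrow> f * g \<in> coord_ring"
  unfolding coord_ring_def
  by clarify (rule exI, rule conjI, rule self.eval_mult[symmetric], simp add: nf_mult_over subfield_K)

lemma coord_ring_poly_mult_y: "p \<in> poly_over K \<Longrightarrow> k < q \<Longrightarrow> poly p x * y ^ k \<in> coord_ring"
  unfolding coord_ring_def
  by (intro CollectI exI[of _ "\<lambda>j. if j = k then p else 0"])
     (auto simp: self.eval_single eval_poly_self poly_over_0 subfield_K)

lemma coord_ring_poly: "p \<in> poly_over K \<Longrightarrow> poly p x \<in> coord_ring"
  using coord_ring_poly_mult_y[of p 0] q_ge_2 by simp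

lemma coord_ring_const: "a \<in> K \<Longrightarrow> a \<in> coord_ring"
  using coord_ring_poly[of "[:a:]"] by (simp add: poly_over_pCons poly_over_0 subfield_K)

lemma coord_ring_x: "x \<in> coord_ring"
  using coord_ring_poly[of "[:0, 1:]"]
  by (simp add: poly_over_pCons poly_over_0 subfield_K subfield_0 subfield_1)

lemma coord_ring_y: "y \<in> coord_ring"
  using coord_ring_poly_mult_y[of 1 1] q_ge_2 by (simp add: poly_over_1 subfield_K)

text \<open>The fractions form a subfield containing \<open>K\<close>, \<open>x\<close> and
  \<open>y\<close>, hence everything by \<open>generated\<close>.\<close>

lemma coord_ring_fraction: "\<exists>a\<in>coord_ring. \<exists>b\<in>coord_ring. b \<noteq> 0 \<and> f = a / b"
proof -
  define S where "S = {a / b | a b. a \<in> coord_ring \<and> b \<in> coord_ring \<and> b \<noteq> 0}"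
  have 1: "1 \<in> coord_ring" by (simp add: coord_ring_const subfield_1 subfield_K)
  have 0: "0 \<in> coord_ring" by (simp add: coord_ring_const subfield_0 subfield_K)
  have R: "a \<in> S" if "a \<in> coord_ring" for a
    unfolding S_def using that 1 by (intro CollectI exI[of _ a] exI[of _ 1]) auto
  have "is_subfield S"
    unfolding is_subfield_def
  proof (intro conjI ballI)
    show "0 \<in> S" "1 \<in> S" using R 0 1 by auto
  next
    fix f g assume "f \<in> S" "g \<in> S"
    then obtain a b c d where ab: "a \<in> coord_ring" "b \<in> coord_ring" "b \<noteq> 0" "f = a / b"
      and cd: "c \<in> coord_ring" "d \<in> coord_ring" "d \<noteq> 0" "g = c / d" by (auto simp: S_def)
    have "f + g = (a * d + c * b) / (b * d)" using ab cd by (simp add: add_frac_eq)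
    then show "f + g \<in> S" unfolding S_def using ab cd
      by (intro CollectI exI[of _ "a * d + c * b"] exI[of _ "b * d"]) (auto intro!: coord_ring_add coord_ring_mult)
    show "f * g \<in> S" unfolding S_def using ab cd
      by (intro CollectI exI[of _ "a * c"] exI[of _ "b * d"]) (auto intro!: coord_ring_mult)
  next
    fix f assume "f \<in> S"
    then obtain a b where ab: "a \<in> coord_ring" "b \<in> coord_ring" "b \<noteq> 0" "f = a / b" by (auto simp: S_def)
    show "- f \<in> S" unfolding S_def using ab coord_ring_diff[OF 0 ab(1)]
      by (intro CollectI exI[of _ "- a"] exI[of _ b]) auto
    show "inverse f \<in> S"
    proof (cases "f = 0")
      case True
      then show ?thesis using R[OF 0] by simp
    next
      case False
      then show ?thesis unfolding S_def using ab by (intro CollectI exI[of _ b] exI[of _ a]) auto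
    qed
  qed
  then have "S = UNIV"
    by (rule generated) (use R coord_ring_const coord_ring_x coord_ring_y in auto)
  then show ?thesis unfolding S_def by blast
qed

text \<open>
  The monomials \<open>x\<^sup>i y\<^sup>j\<close> with \<open>i \<le> q\<close> span the coordinate ring, and both at infinity and at the
  origin they have pairwise distinct values.
\<close>

definition monomial_span :: "'f set" where
  "monomial_span = {\<Sum>s\<in>S. a s * (x ^ fst s * y ^ snd s) | S a.
     finite S \<and> S \<subseteq> {..q} \<times> UNIV \<and> (\<forall>s. a s \<in> K)}"

lemma monomial_span_add:
  assumes "f \<in> monomial_span" "g \<in> monomial_span"
  shows "f + g \<in> monomial_span"
proof -
  let ?m = "\<lambda>s. x ^ fst s * y ^ snd s"
  obtain S a where S: "finite S" "S \<subseteq> {..q} \<times> UNIV" "\<forall>s. a s \<in> K" "f = (\<Sum>s\<in>S. a s * ?m s)"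
    using assms(1) by (auto simp: monomial_span_def)
  obtain T b where T: "finite T" "T \<subseteq> {..q} \<times> UNIV" "\<forall>s. b s \<in> K" "g = (\<Sum>s\<in>T. b s * ?m s)"
    using assms(2) by (auto simp: monomial_span_def)
  define c where "c = (\<lambda>s. (if s \<in> S then a s else 0) + (if s \<in> T then b s else 0))"
  have "(\<Sum>s\<in>S \<union> T. c s * ?m s)
      = (\<Sum>s\<in>S \<union> T. (if s \<in> S then a s * ?m s else 0)) + (\<Sum>s\<in>S \<union> T. (if s \<in> T then b s * ?m s else 0))"
    unfolding sum.distrib[symmetric] by (rule sum.cong) (auto simp: c_def algebra_simps)
  also have "\<dots> = f + g"
    unfolding S T using S(1) T(1) by (simp add: sum.If_cases Int_absorb1)
  finally have "f + g = (\<Sum>s\<in>S \<union> T. c s * ?m s)" ..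
  moreover have "\<forall>s. c s \<in> K"
    using S T by (auto simp: c_def intro!: subfield_add[OF subfield_K] subfield_0[OF subfield_K])
  ultimately show ?thesis using S T unfolding monomial_span_def by blast
qed

lemma monomial_span_scale:
  assumes "f \<in> monomial_span" "k \<in> K"
  shows "k * f \<in> monomial_span"
proof -
  let ?m = "\<lambda>s. x ^ fst s * y ^ snd s"
  obtain S a where S: "finite S" "S \<subseteq> {..q} \<times> UNIV" "\<forall>s. a s \<in> K" "f = (\<Sum>s\<in>S. a s * ?m s)"
    using assms(1) by (auto simp: monomial_span_def)
  have "k * f = (\<Sum>s\<in>S. (k * a s) * ?m s)" by (simp add: S sum_distrib_left mult.assoc)
  moreover have "\<forall>s. k * a s \<in> K" using S assms by (auto intro: subfield_mult[OF subfield_K])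
  ultimately show ?thesis using S unfolding monomial_span_def by (intro CollectI exI[of _ S] exI[of _ "\<lambda>s. k * a s"]) simp
qed

lemma monomial_span_sum: "(\<And>i. i \<in> I \<Longrightarrow> e i \<in> monomial_span) \<Longrightarrow> sum e I \<in> monomial_span"
proof (induction I rule: infinite_finite_induct)
  case empty
  show ?case unfolding monomial_span_def
    by (intro CollectI exI[of _ "{}"] exI[of _ "\<lambda>_. 0"]) (auto simp: subfield_0[OF subfield_K])
next
  case (infinite I)
  show ?case unfolding monomial_span_def using infinite
    by (intro CollectI exI[of _ "{}"] exI[of _ "\<lambda>_. 0"]) (auto simp: subfield_0[OF subfield_K])
qed (auto intro: monomial_span_add)

text \<open>Here the curve equation is read in the other direction than for normal forms: it bounds
  the exponent of \<open>x\<close> and leaves that of \<open>y\<close> free. At the origin this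
  matters, as \<open>x ^ (q + 1)\<close> and \<open>y\<close> have the same value there. It also
  allows division by powers of \<open>y\<close> later on.\<close>

lemma monomial_in_span: "x ^ i * y ^ j \<in> monomial_span"
proof (induction i arbitrary: j rule: less_induct)
  case (less i)
  show ?case
  proof (cases "i \<le> q")
    case True
    then show ?thesis unfolding monomial_span_def
      by (intro CollectI exI[of _ "{(i, j)}"] exI[of _ "\<lambda>_. 1"]) (auto simp: subfield_1[OF subfield_K])
  next
    case False
    define l where "l = i - (q + 1)"
    have i: "i = l + (q + 1)" using False by (simp add: l_def)
    have "x ^ i * y ^ j = x ^ l * x ^ (q + 1) * y ^ j" by (simp only: i power_add)
    also have "\<dots> = x ^ l * y ^ (j + q) + x ^ l * y ^ (j + 1)"
      by (simp only: curve_eq[symmetric]) (simp add: algebra_simps power_add)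
    finally show ?thesis
      using less.IH[of l "j + q"] less.IH[of l "j + 1"] i by (simp only: monomial_span_add)
  qed
qed

lemma coord_ring_subset_span: "coord_ring \<subseteq> monomial_span"
proof
  fix f assume "f \<in> coord_ring"
  then obtain c where c: "\<And>j. c j \<in> poly_over K" "f = self.eval c" by (auto simp: coord_ring_def)
  have "f = (\<Sum>j<q. \<Sum>i\<le>degree (c j). coeff (c j) i * (x ^ i * y ^ j))"
    by (simp add: c(2) self.eval_def eval_poly_self poly_altdef sum_distrib_right mult.assoc)
  also have "\<dots> \<in> monomial_span"
    using c(1) by (intro monomial_span_sum monomial_span_scale monomial_in_span) (auto simp: poly_overD)
  finally show "f \<in> monomial_span" .
qed

text \<open>The exponent set \<open>T\<close> depends on \<open>f\<close> only and serves all
  suitable places at once; this is what makes the orders at P and at Q comparable.\<close>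

lemma coord_ring_values:
  assumes "f \<in> coord_ring" "f \<noteq> 0"
  obtains T where "finite T" "T \<noteq> {}" "T \<subseteq> {..q} \<times> UNIV"
    "\<And>v. v \<in> places K \<Longrightarrow> inj_on (\<lambda>s. int (fst s) * v x + int (snd s) * v y) ({..q} \<times> UNIV) \<Longrightarrow>
       v f = Min ((\<lambda>s. int (fst s) * v x + int (snd s) * v y) ` T)"
proof -
  let ?m = "\<lambda>s. x ^ fst s * y ^ snd s"
  obtain S a where S: "finite S" "S \<subseteq> {..q} \<times> UNIV" "\<forall>s. a s \<in> K" "f = (\<Sum>s\<in>S. a s * ?m s)"
    using assms(1) coord_ring_subset_span by (auto simp: monomial_span_def)
  define T where "T = {s \<in> S. a s \<noteq> 0}"
  have fT: "f = (\<Sum>s\<in>T. a s * ?m s)"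
    unfolding S(4) T_def using S(1) by (intro sum.mono_neutral_right) auto
  show thesis
  proof (rule that[of T])
    show "finite T" "T \<subseteq> {..q} \<times> UNIV" using S by (auto simp: T_def)
    show ne: "T \<noteq> {}" using fT assms(2) by auto
    fix v assume v: "v \<in> places K"
      and inj: "inj_on (\<lambda>s. int (fst s) * v x + int (snd s) * v y) ({..q} \<times> UNIV)"
    have val: "v (a s * ?m s) = int (fst s) * v x + int (snd s) * v y" if "s \<in> T" for s
      using that S(3)[rule_format, of s] x_neq_0 y_neq_0 by (auto simp: T_def place_mult[OF v] place_power[OF v] place_const[OF v])
    have "v (\<Sum>s\<in>T. a s * ?m s) = Min ((\<lambda>s. v (a s * ?m s)) ` T)"
    proof (rule place_sum_distinct[OF v, THEN conjunct2])
      show "inj_on (\<lambda>s. v (a s * ?m s)) T"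
        using inj_on_subset[OF inj \<open>T \<subseteq> {..q} \<times> UNIV\<close>] val by (simp cong: inj_on_cong)
    qed (use \<open>finite T\<close> ne x_neq_0 y_neq_0 in \<open>auto simp: T_def\<close>)
    also have "(\<lambda>s. v (a s * ?m s)) ` T = (\<lambda>s. int (fst s) * v x + int (snd s) * v y) ` T"
      using val by (intro image_cong) auto
    finally show "v f = Min ((\<lambda>s. int (fst s) * v x + int (snd s) * v y) ` T)" using fT by simp
  qed
qed

text \<open>On the coordinate ring both places are computed by the same minimum, scaled by
  \<open>k\<close> and \<open>l\<close>; passing to fractions, all values of \<open>v\<close> are
  multiples of \<open>k\<close> and all values of \<open>w\<close> multiples of \<open>l\<close>.
  Each place takes the value 1, so both factors are 1. With \<open>w = v\<close> this yields the
  exact values of \<open>x\<close> and \<open>y\<close>, with arbitrary \<open>w\<close> the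
  uniqueness of the place.\<close>

lemma place_determined:
  assumes v: "v \<in> places K" "v x = k * A" "v y = k * B" "k > 0"
    and w: "w \<in> places K" "w x = l * A" "w y = l * B" "l > 0"
    and inj: "inj_on (\<lambda>s. int (fst s) * A + int (snd s) * B) ({..q} \<times> UNIV)"
  shows "k = 1 \<and> v = w"
proof -
  let ?g = "\<lambda>s. int (fst s) * A + int (snd s) * B"
  have ring: "\<exists>m. v f = k * m \<and> w f = l * m" if "f \<in> coord_ring" "f \<noteq> 0" for f
  proof -
    obtain T where T: "finite T" "T \<noteq> {}"
      "\<And>v. v \<in> places K \<Longrightarrow> inj_on (\<lambda>s. int (fst s) * v x + int (snd s) * v y) ({..q} \<times> UNIV) \<Longrightarrow>
       v f = Min ((\<lambda>s. int (fst s) * v x + int (snd s) * v y) ` T)"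
      by (rule coord_ring_values[OF \<open>f \<in> coord_ring\<close> \<open>f \<noteq> 0\<close>]) blast
    have *: "u f = n * Min (?g ` T)" if u: "u \<in> places K" "u x = n * A" "u y = n * B" "n > 0" for u n
    proof -
      have eq: "(\<lambda>s. int (fst s) * u x + int (snd s) * u y) = (\<lambda>s. n * ?g s)"
        by (simp add: u algebra_simps)
      have "inj_on (\<lambda>s. int (fst s) * u x + int (snd s) * u y) ({..q} \<times> UNIV)"
        unfolding eq using inj u(4) by (auto simp: inj_on_def)
      then have "u f = Min ((\<lambda>s. n * ?g s) ` T)" using T(3)[OF u(1)] unfolding eq by simp
      also have "\<dots> = Min ((\<lambda>m. n * m) ` ?g ` T)" by (simp add: image_image)
      also have "\<dots> = n * Min (?g ` T)"
        using u(4) T(1,2) by (intro mono_Min_commute[symmetric]) (auto simp: mono_def)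
      finally show ?thesis .
    qed
    show ?thesis using *[OF v] *[OF w] by blast
  qed
  have field: "\<exists>m. v f = k * m \<and> w f = l * m" if "f \<noteq> 0" for f
  proof -
    obtain a b where ab: "a \<in> coord_ring" "b \<in> coord_ring" "b \<noteq> 0" "f = a / b"
      using coord_ring_fraction by blast
    have a0: "a \<noteq> 0" using ab that by auto
    obtain m n where "v a = k * m" "w a = l * m" "v b = k * n" "w b = l * n"
      using ring[OF ab(1) a0] ring[OF ab(2,3)] by blast
    then show ?thesis
      using ab a0 v w by (intro exI[of _ "m - n"]) (simp add: place_divide right_diff_distrib)
  qed
  obtain t where "t \<noteq> 0" "v t = 1" using v(1) by (auto simp: places_def)
  then have k: "k = 1" using field[of t] v(4) by (metis zmult_eq_1_iff less_irrefl neg_0_less_iff_less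
        not_one_less_zero order_less_trans zero_less_one)
  obtain t' where "t' \<noteq> 0" "w t' = 1" using w(1) by (auto simp: places_def)
  then have l: "l = 1" using field[of t'] w(4) by (metis zmult_eq_1_iff less_irrefl neg_0_less_iff_less
        not_one_less_zero order_less_trans zero_less_one)
  have "v f = w f" for f
    using field[of f] k l place_zero[OF v(1)] place_zero[OF w(1)] by (cases "f = 0") auto
  then show ?thesis using k by auto
qed

lemma inj_infinity: "inj_on (\<lambda>s. int (fst s) * (- int q) + int (snd s) * (- (int q + 1))) ({..q} \<times> UNIV)"
proof (rule inj_onI, clarify)
  fix i j i' j' :: nat assume le: "i \<le> q" "i' \<le> q"
    and "int (fst (i, j)) * (- int q) + int (snd (i, j)) * (- (int q + 1)) =
         int (fst (i', j')) * (- int q) + int (snd (i', j')) * (- (int q + 1))"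
  \<comment> \<open>Writing \<open>q i + (q + 1) j\<close> as \<open>(q + 1) (i + j) - i\<close>
    exhibits it modulo \<open>q + 1\<close>.\<close>
  then have "(int q + 1) * (int i + int j - int i' - int j') = int i - int i'" by (simp add: algebra_simps)
  moreover from this have "int i + int j - int i' - int j' = 0"
    by (rule small_multiple_eq_0) (use le in auto)
  ultimately show "i = i' \<and> j = j'" by simp
qed

lemma inj_origin: "inj_on (\<lambda>s. int (fst s) * 1 + int (snd s) * (int q + 1)) ({..q} \<times> UNIV)"
proof (rule inj_onI, clarify)
  fix i j i' j' :: nat assume le: "i \<le> q" "i' \<le> q"
    and "int (fst (i, j)) * 1 + int (snd (i, j)) * (int q + 1) =
         int (fst (i', j')) * 1 + int (snd (i', j')) * (int q + 1)"
  then have "(int q + 1) * (int j - int j') = int i' - int i" by (simp add: algebra_simps)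
  moreover from this have "int j - int j' = 0"
    by (rule small_multiple_eq_0) (use le in auto)
  ultimately show "i = i' \<and> j = j'" by simp
qed

text \<open>At a pole of \<open>y\<close> the term \<open>y ^ q\<close> dominates \<open>y\<close>,
  so the left side of the curve equation, and with it \<open>x\<close>, would have a pole.\<close>

lemma y_integral: "v \<in> places K \<Longrightarrow> 0 \<le> v x \<Longrightarrow> 0 \<le> v y"
proof (rule ccontr)
  assume v: "v \<in> places K" and x: "0 \<le> v x" and "\<not> 0 \<le> v y"
  then have neg: "v y < 0" by simp
  then have "int q * v y < 1 * v y" using q_ge_2 by (intro mult_strict_right_mono_neg) auto
  then have "v (y ^ q) < v y" using y_neq_0 v by (simp add: place_power)
  then have "v (y ^ q + y) = v (y ^ q)"
    using place_add_distinct[OF v, of "y ^ q" y] y_neq_0 by (auto simp: min_def)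
  then have "v (x ^ (q + 1)) < 0" using neg \<open>v (y ^ q) < v y\<close> curve_eq by simp
  moreover have "0 \<le> int (q + 1) * v x" using x by (intro mult_nonneg_nonneg) auto
  ultimately show False using place_power[OF v x_neq_0, of "q + 1"] by simp
qed

lemma values_infinity_scaled:
  assumes v: "v \<in> places K" and x: "v x < 0"
  obtains k where "k > 0" "v x = k * (- int q)" "v y = k * (- (int q + 1))"
proof -
  have y: "v y < 0"
  proof (rule ccontr)
    assume "\<not> v y < 0"
    then have "ord_ge v 0 y" by (simp add: ord_ge_def)
    then have "ord_ge v 0 (y ^ q + y)"
      using q_ge_2 by (intro ord_ge_add[OF v] ord_ge_power[OF v]) auto
    then have "0 \<le> int (q + 1) * v x"
      using place_power[OF v x_neq_0, of "q + 1"] x_neq_0 unfolding curve_eq by (simp add: ord_ge_def)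
    then show False using x by (simp add: zero_le_mult_iff)
  qed
  then have "int q * v y < 1 * v y" using q_ge_2 by (intro mult_strict_right_mono_neg) auto
  then have less: "v (y ^ q) < v y" using y_neq_0 v by (simp add: place_power)
  then have "v (y ^ q + y) = v (y ^ q)"
    using place_add_distinct[OF v, of "y ^ q" y] y_neq_0 by (auto simp: min_def)
  then have eq: "int q * v y = (int q + 1) * v x"
    using place_power[OF v x_neq_0, of "q + 1"] place_power[OF v y_neq_0, of q] curve_eq by simp
  show thesis
  \<comment> \<open>As \<open>q\<close> and \<open>q + 1\<close> are consecutive, the common factor
    in \<open>q v(y) = (q + 1) v(x)\<close> is just the difference of the two values.\<close>
  proof (rule that[of "v x - v y"])
    show vx: "v x = (v x - v y) * (- int q)" using eq by (simp add: algebra_simps)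
    show "v y = (v x - v y) * (- (int q + 1))" using eq by (simp add: algebra_simps)
    show "v x - v y > 0"
    proof (rule ccontr)
      assume "\<not> 0 < v x - v y"
      then have "0 \<le> (v x - v y) * (- int q)" by (intro mult_nonpos_nonpos) auto
      then show False using vx x by simp
    qed
  qed
qed

text \<open>Near the origin \<open>y ^ q\<close> is negligible against \<open>y\<close>, so
  \<open>y\<close> has the order of \<open>x ^ (q + 1)\<close>: the line \<open>y = 0\<close> is the
  tangent there and meets the curve nowhere else.\<close>

lemma values_origin_scaled:
  assumes v: "v \<in> places K" and x: "v x > 0" and y: "v y > 0"
  shows "v y = v x * (int q + 1)"
proof -
  have "1 * v y < int q * v y" using q_ge_2 y by (intro mult_strict_right_mono) auto
  then have less: "v y < v (y ^ q)" using y_neq_0 v by (simp add: place_power)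
  then have "v (y ^ q + y) = v y"
    using place_add_distinct[OF v, of "y ^ q" y] y_neq_0 by (auto simp: min_def)
  then show ?thesis using place_power[OF v x_neq_0, of "q + 1"] curve_eq by (simp add: algebra_simps)
qed

lemma infinity_unique:
  assumes "v \<in> places K" "v x < 0" "w \<in> places K" "w x < 0"
  shows "v = w"
  using values_infinity_scaled[OF assms(1,2)] values_infinity_scaled[OF assms(3,4)]
    place_determined[OF assms(1) _ _ _ assms(3) _ _ _ inj_infinity] by metis

lemma values_infinity:
  assumes "v \<in> places K" "v x < 0"
  shows "v x = - int q" "v y = - (int q + 1)"
proof -
  obtain k where k: "k > 0" "v x = k * (- int q)" "v y = k * (- (int q + 1))"
    using values_infinity_scaled[OF assms] .
  then have "k = 1" using place_determined[OF assms(1) k(2,3,1) assms(1) k(2,3,1) inj_infinity] by simp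
  then show "v x = - int q" "v y = - (int q + 1)" using k by simp_all
qed

lemma origin_unique:
  assumes v: "v \<in> places K" "v x > 0" "v y > 0" and w: "w \<in> places K" "w x > 0" "w y > 0"
  shows "v = w"
  using place_determined[OF v(1) _ values_origin_scaled[OF v] v(2) w(1) _ values_origin_scaled[OF w] w(2) inj_origin]
  by simp

lemma values_origin:
  assumes v: "v \<in> places K" "v x > 0" "v y > 0"
  shows "v x = 1" "v y = int q + 1"
proof -
  show "v x = 1"
    using place_determined[OF v(1) _ values_origin_scaled[OF v] v(2) v(1) _ values_origin_scaled[OF v] v(2) inj_origin]
    by simp
  then show "v y = int q + 1" using values_origin_scaled[OF v] by simp
qed

end

lemma rational_point_place: "v \<in> rational_points K \<Longrightarrow> v \<in> places K"
  by (simp add: rational_points_def)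

lemma rational_point_residue:
  assumes "v \<in> rational_points K" "is_subfield K" "ord_ge v 0 f"
  obtains a where "a \<in> K" "ord_ge v 1 (f - a)"
proof (cases "f = 0")
  case True
  then show thesis using that[of 0] assms by (simp add: subfield_0)
next
  case False
  then obtain a where "a \<in> K" "f - a = 0 \<or> 0 < v (f - a)"
    using assms by (auto simp: rational_points_def ord_ge_def)
  then show thesis using that[of a] by (auto simp: ord_ge_def)
qed

context hermitian_curve
begin

section \<open>Multiples in \<open>K[x]\<close>\<close>

context
  fixes P :: "'f \<Rightarrow> int"
  assumes P: "P \<in> rational_points K" and P_x: "P x < 0"
begin

lemma P_place: "P \<in> places K"
  using P by (rule rational_point_place)

lemma coord_ring_value_infinity:
  assumes "f \<in> coord_ring" "f \<noteq> 0"
  shows "P f \<le> 0"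
proof -
  obtain T where T: "finite T" "T \<noteq> {}"
      "\<And>v. v \<in> places K \<Longrightarrow> inj_on (\<lambda>s. int (fst s) * v x + int (snd s) * v y) ({..q} \<times> UNIV) \<Longrightarrow>
       v f = Min ((\<lambda>s. int (fst s) * v x + int (snd s) * v y) ` T)"
    by (rule coord_ring_values[OF assms]) blast
  have "P f = Min ((\<lambda>s. int (fst s) * P x + int (snd s) * P y) ` T)"
    using T(3)[OF P_place] inj_infinity values_infinity[OF P_place P_x] by simp
  also have "\<dots> \<in> (\<lambda>s. int (fst s) * P x + int (snd s) * P y) ` T"
    using T by (intro Min_in) auto
  finally obtain s where "P f = int (fst s) * P x + int (snd s) * P y" by auto
  moreover have "int (fst s) * P x \<le> 0" "int (snd s) * P y \<le> 0"
    using P_x values_infinity(2)[OF P_place P_x] by (auto intro: mult_nonneg_nonpos)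
  ultimately show ?thesis by simp
qed

text \<open>A stand-in for L(nP): that the coordinate ring contains every function regular outside P
  is known only later, and this set is used in the proof.\<close>

definition pole_bounded :: "nat \<Rightarrow> 'f set" where
  "pole_bounded n = {f \<in> coord_ring. ord_ge P (- int n) f}"

lemma pole_bounded_0: "pole_bounded 0 \<subseteq> K"
proof
  fix f assume f: "f \<in> pole_bounded 0"
  then obtain a where a: "a \<in> K" "ord_ge P 1 (f - a)"
    using rational_point_residue[OF P subfield_K, of f] by (auto simp: pole_bounded_def)
  have "f - a \<in> coord_ring" using f a by (simp add: pole_bounded_def coord_ring_diff coord_ring_const)
  then have "f - a = 0" using coord_ring_value_infinity[of "f - a"] a(2)
    by (cases "f - a = 0") (simp_all add: ord_ge_def)
  then show "f \<in> K" using a by simp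
qed

text \<open>Allowing one more pole order adds at most one dimension. If \<open>g\<close> has the new
  order exactly, \<open>f / g\<close> is integral at P and, P being rational, has a residue
  \<open>a\<close> in \<open>K\<close>; then \<open>f - a * g\<close> has a smaller pole.\<close>

lemma pole_bounded_Suc:
  "\<exists>g. pole_bounded (Suc n) \<subseteq> (\<lambda>(a, h). a * g + h) ` (K \<times> pole_bounded n)"
proof (cases "\<exists>g\<in>coord_ring. g \<noteq> 0 \<and> P g = - int (Suc n)")
  case True
  then obtain g where g: "g \<in> coord_ring" "g \<noteq> 0" "P g = - int (Suc n)" by auto
  have "f \<in> (\<lambda>(a, h). a * g + h) ` (K \<times> pole_bounded n)" if f: "f \<in> pole_bounded (Suc n)" for f
  proof -
    have "ord_ge P (- int (Suc n) + int (Suc n)) (f * inverse g)"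
      using f g by (intro ord_ge_mult[OF P_place]) (auto simp: pole_bounded_def ord_ge_def place_inverse[OF P_place])
    then obtain a where a: "a \<in> K" "ord_ge P 1 (f * inverse g - a)"
      using rational_point_residue[OF P subfield_K] by (metis add.left_inverse)
    have "ord_ge P (1 + - int (Suc n)) ((f * inverse g - a) * g)"
      using a g by (intro ord_ge_mult[OF P_place]) (auto simp: ord_ge_def)
    moreover have "(f * inverse g - a) * g = f - a * g" using g by (simp add: algebra_simps)
    ultimately have "f - a * g \<in> pole_bounded n"
      using f g a by (simp add: pole_bounded_def coord_ring_diff coord_ring_mult coord_ring_const)
    then show ?thesis using a by (intro image_eqI[of _ _ "(a, f - a * g)"]) auto
  qed
  then show ?thesis by blast
next
  case False
  have "f \<in> (\<lambda>(a, h). a * 0 + h) ` (K \<times> pole_bounded n)" if f: "f \<in> pole_bounded (Suc n)" for f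
  proof -
    have "f \<in> pole_bounded n" using f False by (force simp: pole_bounded_def ord_ge_def)
    then show ?thesis using subfield_0[OF subfield_K] by (intro image_eqI[of _ _ "(0, f)"]) auto
  qed
  then show ?thesis by blast
qed

lemma finite_pole_bounded: "finite (pole_bounded n)"
proof (induction n)
  case 0
  then show ?case using pole_bounded_0 finite_K finite_subset by blast
next
  case (Suc n)
  then show ?case using pole_bounded_Suc[of n] finite_K
    by (meson finite_SigmaI finite_imageI finite_subset)
qed

lemma card_pole_bounded_add: "card (pole_bounded (n + m)) \<le> card K ^ m * card (pole_bounded n)"
proof (induction m)
  case (Suc m)
  obtain g where "pole_bounded (Suc (n + m)) \<subseteq> (\<lambda>(a, h). a * g + h) ` (K \<times> pole_bounded (n + m))"
    using pole_bounded_Suc by blast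
  then have "card (pole_bounded (Suc (n + m))) \<le> card (K \<times> pole_bounded (n + m))"
    by (meson card_image_le card_mono finite_SigmaI finite_imageI finite_K finite_pole_bounded order_trans)
  also have "\<dots> \<le> card K * (card K ^ m * card (pole_bounded n))"
    using Suc by (simp add: card_cartesian_product)
  finally show ?case by (simp add: mult.assoc)
qed auto

lemma ord_ge_poly_infinity:
  assumes "p \<in> poly_over K" "degree p \<le> k"
  shows "ord_ge P (- int (q * k)) (poly p x)"
proof -
  have "ord_ge P (- int (q * k)) (\<Sum>i\<in>I. coeff p i * x ^ i)" if "finite I" "I \<subseteq> {..degree p}" for I
    using that
  proof (induction I rule: finite_induct)
    case (insert i I)
    have "int q * int i \<le> int q * int k" using insert.prems assms by (intro mult_left_mono) auto
    then have "ord_ge P (- int (q * k)) (x ^ i)"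
      using values_infinity(1)[OF P_place P_x] x_neq_0 by (simp add: ord_ge_def place_power[OF P_place] mult.commute)
    then have "ord_ge P (0 + - int (q * k)) (coeff p i * x ^ i)"
      using assms by (intro ord_ge_mult[OF P_place] ord_ge_const[OF P_place]) (auto simp: poly_overD)
    then show ?case using insert by (auto intro!: ord_ge_add[OF P_place])
  qed auto
  from this[of "{..degree p}"] show ?thesis by (simp add: poly_altdef)
qed

text \<open>
  Multiplication by \<open>b\<close> embeds the functions with poles of order at most \<open>n\<close> at infinity with bounded
  index, so it must meet the polynomials in \<open>x\<close>; as \<open>K\<close> is finite, this is a pigeonhole argument.
\<close>

lemma coord_ring_divides_poly:
  assumes b: "b \<in> coord_ring" "b \<noteq> 0"
  obtains h a where "h \<in> poly_over K" "h \<noteq> 0" "a \<in> coord_ring" "poly h x = b * a"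
proof -
  define m where "m = nat (- P b)"
  have Pb: "P b = - int m" using coord_ring_value_infinity[OF b] by (simp add: m_def)
  \<comment> \<open>By the index bound, \<open>pole_bounded (n + m)\<close> is at most
    \<open>card K ^ m\<close> times as large as \<open>pole_bounded n\<close>. Polynomials with
    \<open>m + 1\<close> free coefficients supply one more factor \<open>card K\<close>, which
    forces a collision of \<open>g\<close>. The choice of \<open>n\<close> reflects that
    \<open>x\<close> has pole order \<open>q\<close>.\<close>
  define k where "k = Suc m"
  define n where "n = q * k"
  define L where "L = {xs. set xs \<subseteq> K \<and> length xs = k}"
  define g where "g = (\<lambda>(xs, a). poly (Poly xs) x + b * a)"
  have finL: "finite L" unfolding L_def using finite_lists_length_eq[OF finite_K] by simp
  have cardL: "card L = card K ^ k" unfolding L_def using card_lists_length_eq[OF finite_K] by simp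
  have polyL: "Poly xs \<in> poly_over K" "degree (Poly xs) \<le> k" if "xs \<in> L" for xs
  proof -
    have "xs ! i \<in> K" if "i < length xs" for i using that \<open>xs \<in> L\<close> by (auto simp: L_def)
    then show "Poly xs \<in> poly_over K"
      by (auto simp: poly_over_def nth_default_def subfield_0[OF subfield_K])
    show "degree (Poly xs) \<le> k"
      using that by (intro degree_le) (auto simp: L_def nth_default_def)
  qed
  have image: "g ` (L \<times> pole_bounded n) \<subseteq> pole_bounded (n + m)"
  proof clarify
    fix xs a assume xs: "xs \<in> L" and a: "a \<in> pole_bounded n"
    have "ord_ge P (- int n) (poly (Poly xs) x)"
      using ord_ge_poly_infinity[OF polyL[OF xs]] by (simp add: n_def)
    then have "ord_ge P (- int (n + m)) (poly (Poly xs) x)" by (rule ord_ge_mono) simp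
    moreover have "ord_ge P (- int m + - int n) (b * a)"
      using a Pb by (intro ord_ge_mult[OF P_place]) (auto simp: pole_bounded_def ord_ge_def)
    ultimately have "ord_ge P (- int (n + m)) (g (xs, a))"
      unfolding g_def by (auto intro!: ord_ge_add[OF P_place] simp: add.commute)
    moreover have "g (xs, a) \<in> coord_ring"
      unfolding g_def using polyL[OF xs] a b
      by (auto simp: pole_bounded_def intro!: coord_ring_add coord_ring_mult coord_ring_poly)
    ultimately show "g (xs, a) \<in> pole_bounded (n + m)" by (simp add: pole_bounded_def)
  qed
  have "0 \<in> pole_bounded n"
    by (simp add: pole_bounded_def coord_ring_const subfield_0[OF subfield_K])
  then have pos: "card (pole_bounded n) > 0" using finite_pole_bounded by (auto simp: card_gt_0_iff)
  have K1: "card K > 1" using one_less_power[of q 2] q_ge_2 by (simp add: card_K)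
  have "card (pole_bounded (n + m)) \<le> card K ^ m * card (pole_bounded n)" by (rule card_pole_bounded_add)
  also have "\<dots> < card K ^ k * card (pole_bounded n)"
    using K1 pos by (simp add: k_def)
  also have "\<dots> = card (L \<times> pole_bounded n)" by (simp add: card_cartesian_product cardL)
  finally have "\<not> inj_on g (L \<times> pole_bounded n)"
    using card_inj_on_le[OF _ image finite_pole_bounded] by auto
  then obtain xs a ys a' where *: "xs \<in> L" "a \<in> pole_bounded n" "ys \<in> L" "a' \<in> pole_bounded n"
    "g (xs, a) = g (ys, a')" "(xs, a) \<noteq> (ys, a')" by (auto simp: inj_on_def)
  have eq: "poly (Poly xs - Poly ys) x = b * (a' - a)" using *(5) by (simp add: g_def algebra_simps)
  have ne: "Poly xs - Poly ys \<noteq> 0"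
  proof
    assume 0: "Poly xs - Poly ys = 0"
    then have "a = a'" using eq b by simp
    moreover have "xs = ys"
    proof (rule nth_equalityI)
      show len: "length xs = length ys" using * by (simp add: L_def)
      fix i assume i: "i < length xs"
      have "coeff (Poly xs) i = coeff (Poly ys) i" using 0 by simp
      then show "xs ! i = ys ! i" using i len by (simp add: nth_default_def)
    qed
    ultimately show False using * by simp
  qed
  show thesis
    by (rule that[OF _ ne _ eq]) (use * polyL in \<open>auto simp: pole_bounded_def intro!: poly_over_diff[OF subfield_K] coord_ring_diff\<close>)
qed

text \<open>The monomials \<open>x ^ i * y ^ j\<close> with \<open>j < q\<close> have distinct pole
  orders at infinity, so they cannot cancel. Hence the powers of \<open>y\<close> below
  \<open>q\<close> are independent over \<open>K[x]\<close>, which is the irreducibility of the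
  curve equation.\<close>

lemma normal_form_zero:
  assumes c: "\<And>j. c j \<in> poly_over K" and zero: "self.eval c = 0" and "j < q"
  shows "c j = 0"
proof (rule ccontr)
  assume nz: "c j \<noteq> 0"
  define S where "S = (SIGMA j:{..<q}. {i. i \<le> degree (c j) \<and> coeff (c j) i \<noteq> 0})"
  define e where "e = (\<lambda>(j, i). coeff (c j) i * (x ^ i * y ^ j))"
  have "self.eval c = (\<Sum>j<q. \<Sum>i\<le>degree (c j). coeff (c j) i * (x ^ i * y ^ j))"
    by (simp add: self.eval_def eval_poly_self poly_altdef sum_distrib_right mult.assoc)
  also have "\<dots> = (\<Sum>j<q. \<Sum>i\<in>{i. i \<le> degree (c j) \<and> coeff (c j) i \<noteq> 0}. coeff (c j) i * (x ^ i * y ^ j))"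
    by (intro sum.cong sum.mono_neutral_right) auto
  also have "\<dots> = sum e S" unfolding S_def e_def by (subst sum.Sigma) auto
  finally have "sum e S = 0" using zero by simp
  moreover have "sum e S \<noteq> 0 \<and> P (sum e S) = Min ((\<lambda>s. P (e s)) ` S)"
  proof (rule place_sum_distinct[OF P_place])
    show "finite S" unfolding S_def by auto
    have "(j, degree (c j)) \<in> S" using assms(3) nz by (auto simp: S_def)
    then show "S \<noteq> {}" by auto
    show "e s \<noteq> 0" if "s \<in> S" for s using that x_neq_0 y_neq_0 by (auto simp: S_def e_def)
    show "inj_on (\<lambda>s. P (e s)) S"
    proof (rule inj_onI, clarify)
      fix j i j' i' assume S: "(j, i) \<in> S" "(j', i') \<in> S" and eq: "P (e (j, i)) = P (e (j', i'))"
      have val: "P (e (j, i)) = - (int q * int i + (int q + 1) * int j)" if "(j, i) \<in> S" for j i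
      proof -
        have "P (e (j, i)) = int i * P x + int j * P y"
          using that x_neq_0 y_neq_0 c
          by (simp add: S_def e_def place_mult[OF P_place] place_power[OF P_place] place_const[OF P_place] poly_overD)
        then show ?thesis unfolding values_infinity[OF P_place P_x] by (simp add: algebra_simps)
      qed
      \<comment> \<open>Now \<open>j\<close> is bounded by \<open>q - 1\<close>, so the comparison
        runs modulo \<open>q\<close> instead of \<open>q + 1\<close>.\<close>
      have "(int (q - 1) + 1) * (int i + int j - int i' - int j') = int j' - int j"
        using eq val[OF S(1)] val[OF S(2)] q_ge_2 by (simp add: algebra_simps of_nat_diff)
      moreover from this have "int i + int j - int i' - int j' = 0"
        by (rule small_multiple_eq_0) (use S in \<open>auto simp: S_def\<close>)
      ultimately show "j = j' \<and> i = i'" by simp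
    qed
  qed
  ultimately show False by simp
qed

lemma normal_form_unique:
  assumes "\<And>j. c j \<in> poly_over K" "\<And>j. d j \<in> poly_over K" "self.eval c = self.eval d" "j < q"
  shows "c j = d j"
  using normal_form_zero[of "\<lambda>j. c j - d j" j] assms by (simp add: self.eval_diff poly_over_diff[OF subfield_K])

end

end

section \<open>Power series points\<close>

text \<open>The coefficients of the solution \<open>T\<close> of \<open>T ^ q + T = u\<close> with
  constant term \<open>b\<close>. Raising to the \<open>q\<close>-th power moves coefficient
  \<open>n\<close> to position \<open>q n\<close>, so coefficient \<open>n\<close> of the equation
  determines that of \<open>T\<close> from an earlier one. The guard \<open>q < 2\<close> only
  secures termination.\<close>

function artin_schreier_coeff :: "nat \<Rightarrow> 'a::comm_ring_1 \<Rightarrow> (nat \<Rightarrow> 'a) \<Rightarrow> nat \<Rightarrow> 'a" where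
  "artin_schreier_coeff q b u n = (if n = 0 \<or> q < 2 then b
     else u n - (if q dvd n then artin_schreier_coeff q b u (n div q) ^ q else 0))"
  by pat_completeness auto
termination by (relation "measure (\<lambda>(q, b, u, n). n)") auto

declare artin_schreier_coeff.simps [simp del]

context hermitian_curve
begin

text \<open>By additivity of Frobenius, removing the constant term reduces the claim at
  \<open>n\<close> to the claim at \<open>n - q\<close> for the shifted series.\<close>

lemma fps_frobenius_nth:
  fixes T :: "'r::comm_ring_1 fps"
  assumes "CHAR('r) = CHAR('f)"
  shows "(T ^ q) $ n = (if q dvd n then (T $ (n div q)) ^ q else 0)"
proof (induction n arbitrary: T rule: less_induct)
  case (less n)
  have q: "0 < q" using q_ge_2 by simp
  have "T = fps_const (T $ 0) + fps_X * fps_shift 1 T"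
    by (rule fps_ext) (simp add: fps_X_mult_nth)
  then have "T ^ q = (fps_const (T $ 0) + fps_X * fps_shift 1 T) ^ q" by simp
  also have "\<dots> = fps_const (T $ 0) ^ q + (fps_X * fps_shift 1 T) ^ q"
    using frobenius_add[where 'r = "'r fps" and n = 1] assms by simp
  also have "\<dots> = fps_const ((T $ 0) ^ q) + fps_X ^ q * fps_shift 1 T ^ q"
    by (simp add: fps_const_power power_mult_distrib)
  finally have T: "T ^ q = fps_const ((T $ 0) ^ q) + fps_X ^ q * fps_shift 1 T ^ q" .
  show ?case
  proof (cases "n < q")
    case True
    then have "q dvd n \<longleftrightarrow> n = 0" using q by (auto dest: dvd_imp_le)
    then show ?thesis using True by (simp add: T fps_X_power_mult_nth)
  next
    case False
    then obtain m where m: "n = q + m" using le_Suc_ex not_less by blast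
    have "(fps_shift 1 T ^ q) $ m = (if q dvd m then (fps_shift 1 T $ (m div q)) ^ q else 0)"
      using m q by (intro less.IH) simp
    then show ?thesis using m q by (simp add: T fps_X_power_mult_nth)
  qed
qed

text \<open>Unramifiedness over the affine line in the form needed: as \<open>Y ^ q + Y\<close> has
  derivative 1 in \<open>Y\<close>, every solution for the constant terms lifts.\<close>

lemma fps_point:
  fixes u :: "'r::comm_ring_1 fps"
  assumes "CHAR('r) = CHAR('f)" "u $ 0 = b ^ q + b"
  obtains T where "T ^ q + T = u" "T $ 0 = b"
proof -
  define T where "T = Abs_fps (artin_schreier_coeff q b (fps_nth u))"
  have T0: "T $ 0 = b" unfolding T_def by (simp add: artin_schreier_coeff.simps)
  have "(T ^ q + T) $ n = u $ n" for n
  proof (cases "n = 0")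
    case True
    then show ?thesis using assms(2) T0 by (simp add: fps_frobenius_nth[OF assms(1)])
  next
    case False
    then have "T $ n = u $ n - (if q dvd n then (T $ (n div q)) ^ q else 0)"
      unfolding T_def using q_ge_2 by (simp add: artin_schreier_coeff.simps[of q b _ n])
    then show ?thesis by (simp add: fps_frobenius_nth[OF assms(1)])
  qed
  then have "T ^ q + T = u" by (intro fps_ext) simp
  then show thesis using that T0 by blast
qed

text \<open>An order function on a ring extends to its fractions by differences; multiplicativity
  makes the choice of the fraction irrelevant, and \<open>t\<close> normalizes the result.\<close>

lemma place_from_coord_ring:
  fixes w :: "'f \<Rightarrow> nat"
  assumes mult: "\<And>f g. f \<in> coord_ring \<Longrightarrow> g \<in> coord_ring \<Longrightarrow> f \<noteq> 0 \<Longrightarrow> g \<noteq> 0 \<Longrightarrow> w (f * g) = w f + w g"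
    and add: "\<And>f g. f \<in> coord_ring \<Longrightarrow> g \<in> coord_ring \<Longrightarrow> f \<noteq> 0 \<Longrightarrow> g \<noteq> 0 \<Longrightarrow> f + g \<noteq> 0 \<Longrightarrow>
      min (w f) (w g) \<le> w (f + g)"
    and const: "\<And>a. a \<in> K \<Longrightarrow> a \<noteq> 0 \<Longrightarrow> w a = 0"
    and t: "t \<in> coord_ring" "t \<noteq> 0" "w t = 1"
  obtains v where "v \<in> places K" "\<And>f. f \<in> coord_ring \<Longrightarrow> f \<noteq> 0 \<Longrightarrow> v f = int (w f)"
proof -
  let ?R = "\<lambda>f (a, b). a \<in> coord_ring \<and> b \<in> coord_ring \<and> a \<noteq> 0 \<and> b \<noteq> 0 \<and> f = a / b"
  define r where "r = (\<lambda>f. SOME ab. ?R f ab)"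
  define v where "v = (\<lambda>f. if f = 0 then 0 else int (w (fst (r f))) - int (w (snd (r f))))"
  have 1: "1 \<in> coord_ring" by (simp add: coord_ring_const subfield_1 subfield_K)
  have frac: "\<exists>a b. ?R f (a, b)" if "f \<noteq> 0" for f
    using coord_ring_fraction[of f] that by auto
  have v_frac: "v (a / b) = int (w a) - int (w b)"
    if ab: "a \<in> coord_ring" "b \<in> coord_ring" "a \<noteq> 0" "b \<noteq> 0" for a b
  proof -
    have "?R (a / b) (r (a / b))"
      unfolding r_def by (rule someI[of _ "(a, b)"]) (use ab in auto)
    then obtain c d where r: "r (a / b) = (c, d)" and cd: "c \<in> coord_ring" "d \<in> coord_ring" "c \<noteq> 0" "d \<noteq> 0" "a / b = c / d"
      by (cases "r (a / b)") auto
    have "a * d = c * b" using cd ab by (simp add: frac_eq_eq)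
    then have "w a + w d = w c + w b" using mult[of a d] mult[of c b] ab cd by simp
    then show ?thesis using ab r by (simp add: v_def)
  qed
  have w1: "w 1 = 0" using const[OF subfield_1[OF subfield_K]] by simp
  have v_ring: "v f = int (w f)" if "f \<in> coord_ring" "f \<noteq> 0" for f
    using v_frac[OF that(1) 1 that(2)] w1 by simp
  have "v \<in> places K"
    unfolding places_def
  proof (intro CollectI conjI allI impI ballI)
    show "v 0 = 0" by (simp add: v_def)
    show "\<exists>t. t \<noteq> 0 \<and> v t = 1" using t v_ring by auto
    show "v a = 0" if "a \<in> K" "a \<noteq> 0" for a using v_ring const that coord_ring_const by simp
  next
    fix f g :: 'f assume "f \<noteq> 0" "g \<noteq> 0"
    then obtain a b c d where ab: "a \<in> coord_ring" "b \<in> coord_ring" "a \<noteq> 0" "b \<noteq> 0" "f = a / b"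
      and cd: "c \<in> coord_ring" "d \<in> coord_ring" "c \<noteq> 0" "d \<noteq> 0" "g = c / d"
      using frac[of f] frac[of g] by auto
    have "v (f * g) = int (w (a * c)) - int (w (b * d))"
      using v_frac[of "a * c" "b * d"] ab cd by (simp add: coord_ring_mult)
    then show "v (f * g) = v f + v g" using ab cd v_frac mult by simp
    assume "f + g \<noteq> 0"
    have eq: "f + g = (a * d + c * b) / (b * d)" using ab cd by (simp add: add_frac_eq)
    with \<open>f + g \<noteq> 0\<close> have n0: "a * d + c * b \<noteq> 0" by auto
    have "v (f + g) = int (w (a * d + c * b)) - int (w (b * d))"
      unfolding eq using n0 ab cd by (intro v_frac) (auto intro!: coord_ring_add coord_ring_mult)
    moreover have "min (w (a * d)) (w (c * b)) \<le> w (a * d + c * b)"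
      using n0 ab cd by (intro add) (auto intro!: coord_ring_mult)
    ultimately show "min (v f) (v g) \<le> v (f + g)"
      using ab cd v_frac mult by simp
  qed
  then show thesis using that v_ring by blast
qed

context
  fixes P :: "'f \<Rightarrow> int"
  assumes P: "P \<in> rational_points K" and P_x: "P x < 0"
begin

text \<open>Expanding \<open>x\<close> as \<alpha> plus the series variable and \<open>y\<close> as
  the lifted solution embeds the coordinate ring into power series; the place is the order of
  vanishing. A constant term is the value at (\<alpha>, \<beta>), so positive order means vanishing
  at the point.\<close>

lemma place_at_geometric_point:
  fixes \<alpha> \<beta> :: "'f alg_closure"
  assumes curve: "\<beta> ^ q + \<beta> = \<alpha> ^ (q + 1)" and \<alpha>: "\<alpha> ^ q ^ n = \<alpha>" and n: "n > 0"
  obtains v where "v \<in> places K"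
    "\<And>c. (\<And>j. c j \<in> poly_over K) \<Longrightarrow> self.eval c \<noteq> 0 \<Longrightarrow> 0 \<le> v (self.eval c) \<and>
       (0 < v (self.eval c) \<longleftrightarrow> curve_point.eval to_ac q \<alpha> \<beta> c = 0)"
proof -
  define \<xi> :: "'f alg_closure fps" where "\<xi> = fps_const \<alpha> + fps_X"
  have "(\<xi> ^ (q + 1)) $ 0 = \<beta> ^ q + \<beta>" by (simp add: \<xi>_def curve fps_power_zeroth)
  then obtain \<eta> where \<eta>: "\<eta> ^ q + \<eta> = \<xi> ^ (q + 1)" "\<eta> $ 0 = \<beta>"
    using fps_point[of "\<xi> ^ (q + 1)" \<beta>] by auto
  interpret E: curve_point to_ac q \<alpha> \<beta>
    using q_ge_2 curve by unfold_locales auto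
  interpret S: curve_point "\<lambda>a. fps_const (to_ac a)" q \<xi> \<eta>
    using q_ge_2 \<eta> by unfold_locales auto
  define nf where "nf = (\<lambda>c. \<forall>j::nat. c j \<in> poly_over K)"
  \<comment> \<open>The expansion is defined through a chosen normal form; uniqueness of normal
    forms makes it independent of the choice and hence a ring homomorphism.\<close>
  define \<psi> where "\<psi> = (\<lambda>f. S.eval (SOME c. nf c \<and> self.eval c = f))"
  have \<psi>_eval: "\<psi> (self.eval c) = S.eval c" if "nf c" for c
  proof -
    define d where "d = (SOME d. nf d \<and> self.eval d = self.eval c)"
    have d: "nf d" "self.eval d = self.eval c"
      using someI[of "\<lambda>d. nf d \<and> self.eval d = self.eval c" c] that unfolding d_def by auto
    then have "d j = c j" if "j < q" for j
      using normal_form_unique[OF P P_x, of d c j] that \<open>nf c\<close> by (auto simp: nf_def)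
    then show ?thesis by (simp add: \<psi>_def S.eval_def flip: d_def)
  qed
  have ring: "\<exists>c. nf c \<and> f = self.eval c" if "f \<in> coord_ring" for f
    using that by (auto simp: coord_ring_def nf_def)
  have \<psi>_mult: "\<psi> (f * g) = \<psi> f * \<psi> g" and \<psi>_add: "\<psi> (f + g) = \<psi> f + \<psi> g"
    if fg: "f \<in> coord_ring" "g \<in> coord_ring" for f g
  proof -
    obtain c d where c: "nf c" "f = self.eval c" and d: "nf d" "g = self.eval d"
      using ring fg by metis
    have "nf (nf_mult q c d)" "nf (\<lambda>j. c j + d j)"
      using c d by (auto simp: nf_def nf_mult_over subfield_K poly_over_add)
    from this[THEN \<psi>_eval] show "\<psi> (f * g) = \<psi> f * \<psi> g" "\<psi> (f + g) = \<psi> f + \<psi> g"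
      using c d by (simp_all add: \<psi>_eval self.eval_mult S.eval_mult self.eval_add S.eval_add)
  qed
  have \<psi>_poly: "\<psi> (poly p x) = S.eval_poly p" if "p \<in> poly_over K" for p
  proof -
    have "nf (\<lambda>j. if j = 0 then p else 0)" using that by (simp add: nf_def poly_over_0 subfield_K)
    from \<psi>_eval[OF this] show ?thesis
      using q_ge_2 by (simp add: self.eval_single S.eval_single eval_poly_self)
  qed
  have S_poly: "S.eval_poly p = fps_of_poly (pcompose (map_poly to_ac p) [:\<alpha>, 1:])" for p
  proof (induction p)
    case (pCons a p)
    have "fps_of_poly [:\<alpha>, 1:] = \<xi>" by (simp add: \<xi>_def fps_of_poly_pCons)
    then show ?case
      unfolding S.eval_poly_pCons pCons.IH map_poly_pCons[of to_ac, OF to_ac_0] pcompose_pCons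
        fps_of_poly_add fps_of_poly_mult by (simp add: fps_of_poly_const)
  qed simp
  have S_poly_nz: "S.eval_poly p \<noteq> 0" if "p \<noteq> 0" for p
  proof
    assume "S.eval_poly p = 0"
    then have "pcompose (map_poly to_ac p) [:\<alpha>, 1:] = 0" by (simp add: S_poly)
    then have "map_poly to_ac p = 0" by (rule pcompose_eq_0) simp
    then show False using that by (simp add: map_poly_eq_0_iff)
  qed
  \<comment> \<open>Injectivity: \<open>f\<close> divides a nonzero polynomial \<open>h\<close> in
    \<open>x\<close>, whose expansion is \<open>h\<close> composed with \<alpha> plus the variable
    and so nonzero.\<close>
  have \<psi>_nz: "\<psi> f \<noteq> 0" if f: "f \<in> coord_ring" "f \<noteq> 0" for f
  proof
    assume 0: "\<psi> f = 0"
    obtain h a where h: "h \<in> poly_over K" "h \<noteq> 0" "a \<in> coord_ring" "poly h x = f * a"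
      using coord_ring_divides_poly[OF P P_x f] .
    then have "S.eval_poly h = 0" using \<psi>_poly[of h] \<psi>_mult[OF f(1), of a] 0 by simp
    then show False using S_poly_nz h by simp
  qed
  have S_poly_0: "S.eval_poly p $ 0 = E.eval_poly p" for p
  proof (induction p)
    case (pCons a p)
    have "\<xi> $ 0 = \<alpha>" by (simp add: \<xi>_def)
    then show ?case using pCons.IH by (simp add: S.eval_poly_pCons E.eval_poly_pCons)
  qed simp
  have S_eval_0: "S.eval c $ 0 = E.eval c" for c
    by (simp add: S.eval_def E.eval_def fps_sum_nth S_poly_0 fps_power_zeroth \<eta>)
  \<comment> \<open>A uniformizer is needed, but \<open>x\<close> minus \<alpha> need not lie in the
    function field. The polynomial \<open>T\<close> has coefficients in \<open>K\<close> and a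
    simple root at \<alpha>: as \<alpha> is fixed by the \<open>q ^ n\<close>-th power,
    \<open>T\<close> expands to \<open>fps_X ^ q ^ n - fps_X\<close>, of order 1.\<close>
  define T where "T = monom 1 (q ^ n) - monom (1 :: 'f) 1"
  have qn: "q ^ n > 1" using q_ge_2 n by (intro one_less_power) auto
  have T: "T \<in> poly_over K" unfolding T_def
    by (intro poly_over_diff poly_over_monom subfield_K subfield_1)
  have "S.eval_poly T = \<xi> ^ q ^ n - \<xi>"
    by (simp add: T_def S.eval_poly_diff S.eval_poly_monom)
  also have "\<xi> ^ q ^ n = fps_const (\<alpha> ^ q ^ n) + fps_X ^ q ^ n"
    unfolding \<xi>_def by (subst frobenius_add) (auto simp: fps_const_power)
  finally have ST: "S.eval_poly T = fps_X ^ q ^ n - fps_X" by (simp add: \<alpha> \<xi>_def)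
  have sub: "subdegree (\<psi> (poly T x)) = 1"
    unfolding \<psi>_poly[OF T] ST using qn q_ge_2 n by (intro subdegreeI) (auto simp: fps_X_power_nth)
  have "coeff T 1 \<noteq> 0" using qn q_ge_2 n by (simp add: T_def)
  then have T0: "T \<noteq> 0" by auto
  obtain v where v: "v \<in> places K" "\<And>f. f \<in> coord_ring \<Longrightarrow> f \<noteq> 0 \<Longrightarrow> v f = int (subdegree (\<psi> f))"
  proof (rule place_from_coord_ring[of "\<lambda>f. subdegree (\<psi> f)" "poly T x"])
    show "subdegree (\<psi> (f * g)) = subdegree (\<psi> f) + subdegree (\<psi> g)"
      if "f \<in> coord_ring" "g \<in> coord_ring" "f \<noteq> 0" "g \<noteq> 0" for f g
      using that by (simp add: \<psi>_mult \<psi>_nz)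
    show "min (subdegree (\<psi> f)) (subdegree (\<psi> g)) \<le> subdegree (\<psi> (f + g))"
      if "f \<in> coord_ring" "g \<in> coord_ring" "f \<noteq> 0" "g \<noteq> 0" "f + g \<noteq> 0" for f g
      using that \<psi>_nz[of "f + g"] by (simp add: \<psi>_add coord_ring_add subdegree_add_ge')
    show "subdegree (\<psi> a) = 0" if "a \<in> K" "a \<noteq> 0" for a
    proof -
      have "\<psi> a = S.eval_poly [:a:]"
        using \<psi>_poly[of "[:a:]"] that by (simp add: poly_over_pCons poly_over_0 subfield_K)
      then show ?thesis by (simp add: S.eval_poly_pCons)
    qed
    show "poly T x \<noteq> 0" using x_not_root T T0 by blast
  qed (use T sub coord_ring_poly in auto)
  show thesis
  proof (rule that[OF v(1)])
    fix c assume c: "\<And>j. c j \<in> poly_over K" and nz: "self.eval c \<noteq> 0"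
    have "self.eval c \<in> coord_ring" using c by (auto simp: coord_ring_def)
    moreover have "\<psi> (self.eval c) = S.eval c" using \<psi>_eval c by (simp add: nf_def)
    ultimately have "v (self.eval c) = int (subdegree (S.eval c))" "S.eval c \<noteq> 0"
      using v(2) nz \<psi>_nz by metis+
    then show "0 \<le> v (self.eval c) \<and> (0 < v (self.eval c) \<longleftrightarrow> E.eval c = 0)"
      using S_eval_0[of c] by (auto simp: subdegree_eq_0_iff zero_less_iff_neq_zero)
  qed
qed

end

end

section \<open>Functions regular outside infinity\<close>

context hermitian_curve
begin

lemma of_nat_q_eq_0:
  assumes "CHAR('r::comm_ring_1) = CHAR('f)"
  shows "of_nat q = (0 :: 'r)"
proof -
  obtain e where e: "q = CHAR('f) ^ e" using q_eq_CHAR_power ..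
  then have "e \<noteq> 0" using q_ge_2 by (cases "e = 0") auto
  then have "CHAR('r) dvd q" using e assms by (simp add: dvd_power)
  then show ?thesis by (simp add: of_nat_eq_0_iff_char_dvd)
qed

text \<open>The \<open>q ^ 2\<close>-th power fixes \<open>K\<close>, so it maps the finite root set
  of \<open>h\<close> to itself and the orbit of \<alpha> repeats. Since powers of Frobenius are
  additive and have no kernel in a field, the repetition can be pulled back to \<alpha>
  itself.\<close>

lemma algebraic_frobenius_periodic:
  fixes \<alpha> :: "'f alg_closure"
  assumes h: "h \<in> poly_over K" "h \<noteq> 0" and root: "poly (map_poly to_ac h) \<alpha> = 0"
  obtains n where "n > 0" "\<alpha> ^ q ^ n = \<alpha>"
proof -
  have frob: "poly (map_poly to_ac p) (z ^ q ^ 2) = poly (map_poly to_ac p) z ^ q ^ 2"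
    if "p \<in> poly_over K" for p z
    using that
  proof (induction p)
    case 0
    then show ?case using q_ge_2 by (simp add: zero_power)
  next
    case (pCons a p)
    have a: "a \<in> K" using poly_overD[OF pCons.prems, of 0] by simp
    have p: "p \<in> poly_over K" using pCons.prems by (auto simp: poly_over_def coeff_pCons split: nat.splits)
    have "to_ac a ^ q ^ 2 = to_ac a"
      using finite_subfield_power_card[OF subfield_K finite_K a] by (simp add: card_K flip: to_ac_power)
    then show ?case
      using pCons.IH[OF p] by (simp add: map_poly_pCons frobenius_add power_mult_distrib)
  qed
  define \<sigma> where "\<sigma> = (\<lambda>k. \<alpha> ^ (q ^ 2) ^ k)"
  have Suc: "\<sigma> (Suc k) = \<sigma> k ^ q ^ 2" for k by (simp only: \<sigma>_def power_Suc2 power_mult)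
  have "poly (map_poly to_ac h) (\<sigma> k) = 0" for k
  proof (induction k)
    case (Suc k)
    then show ?case using frob[OF h(1), of "\<sigma> k"] q_ge_2 by (simp add: \<open>\<sigma> (Suc k) = \<sigma> k ^ q ^ 2\<close> zero_power)
  qed (simp add: \<sigma>_def root)
  then have "range \<sigma> \<subseteq> {z. poly (map_poly to_ac h) z = 0}" by auto
  moreover have "finite {z. poly (map_poly to_ac h) z = 0}"
    using h by (intro poly_roots_finite) (simp add: map_poly_eq_0_iff)
  ultimately have "\<not> inj \<sigma>" using finite_subset finite_imageD infinite_UNIV_nat by blast
  then obtain k l where "k \<noteq> l" "\<sigma> k = \<sigma> l" by (auto simp: inj_on_def)
  then obtain k l where kl: "k < l" "\<sigma> k = \<sigma> l" by (metis nat_neq_iff)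
  have "q ^ (2 * k) * q ^ (2 * (l - k)) = q ^ (2 * l)"
    using kl(1) by (simp add: power_add[symmetric] distrib_left[symmetric] del: mult_Suc_right)
  then have "\<sigma> l = (\<alpha> ^ q ^ (2 * (l - k))) ^ q ^ (2 * k)"
    by (simp add: \<sigma>_def mult.commute flip: power_mult)
  moreover have "\<sigma> k = \<alpha> ^ q ^ (2 * k)" by (simp add: \<sigma>_def power_mult)
  ultimately have "(\<alpha> ^ q ^ (2 * (l - k)) - \<alpha>) ^ q ^ (2 * k) = 0"
    using kl(2) by (simp add: frobenius_diff)
  then have "\<alpha> ^ q ^ (2 * (l - k)) = \<alpha>" by simp
  then show thesis using that[of "2 * (l - k)"] kl(1) by simp
qed

context
  fixes P :: "'f \<Rightarrow> int"
  assumes P: "P \<in> rational_points K" and P_x: "P x < 0"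
begin

lemma regular_imp_coord_ring:
  assumes reg: "\<And>v. v \<in> places K \<Longrightarrow> v \<noteq> P \<Longrightarrow> ord_ge v 0 f"
  shows "f \<in> coord_ring"
proof (cases "f = 0")
  case True
  then show ?thesis by (simp add: coord_ring_const subfield_0 subfield_K)
next
  case f0: False
  \<comment> \<open>The admissible denominators of \<open>f\<close> in \<open>K[x]\<close>; one of
    least degree will be shown to be constant.\<close>
  define good where "good = (\<lambda>h. h \<in> poly_over K \<and> h \<noteq> 0 \<and> poly h x * f \<in> coord_ring)"
  obtain a b where ab: "a \<in> coord_ring" "b \<in> coord_ring" "b \<noteq> 0" "f = a / b"
    using coord_ring_fraction by blast
  obtain h0 a' where "h0 \<in> poly_over K" "h0 \<noteq> 0" "a' \<in> coord_ring" "poly h0 x = b * a'"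
    using coord_ring_divides_poly[OF P P_x ab(2,3)] .
  then have "good h0" using ab coord_ring_mult[of a a'] by (simp add: good_def mult.commute)
  then obtain h where h: "good h" and min: "\<And>g. good g \<Longrightarrow> degree h \<le> degree g"
    using ex_has_least_nat[of good h0 degree] by blast
  show ?thesis
  proof (cases "degree h = 0")
    case True
    then obtain k where k: "h = [:k:]" by (metis degree_0_id)
    have "k \<in> K" "k \<noteq> 0" using h poly_overD[of h K 0] by (auto simp: good_def k)
    then have "inverse k * (poly h x * f) \<in> coord_ring"
      using coord_ring_mult[OF coord_ring_const[OF subfield_inverse[OF subfield_K]]] h
      by (simp add: good_def)
    then show ?thesis using \<open>k \<noteq> 0\<close> by (simp add: k flip: mult.assoc)
  next
    case False
    have hK: "h \<in> poly_over K" "h \<noteq> 0" using h by (auto simp: good_def)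
    define r where "r = (\<lambda>\<alpha> p. poly (map_poly to_ac p) \<alpha> :: 'f alg_closure)"
    have "degree (map_poly to_ac h) > 0" using False by (subst degree_map_poly) auto
    then obtain \<alpha> where \<alpha>: "r \<alpha> h = 0" using alg_closed_imp_poly_has_root unfolding r_def by blast
    obtain n where n: "n > 0" "\<alpha> ^ q ^ n = \<alpha>"
      using algebraic_frobenius_periodic[OF hK] \<alpha> by (auto simp: r_def)
    obtain c where c: "\<And>j. c j \<in> poly_over K" "poly h x * f = self.eval c"
      using h by (auto simp: good_def coord_ring_def)
    have nz: "self.eval c \<noteq> 0" using x_not_root[OF hK] f0 by (simp flip: c(2))
    \<comment> \<open>The roots of \<open>M\<close> are the points of the fibre over \<alpha>. Its
      derivative is 1, since \<open>q\<close> vanishes in the field; so every fibre has exactly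
      \<open>q\<close> points, without exceptional \<alpha>.\<close>
    define M where "M = monom 1 q + monom 1 1 - [:\<alpha> ^ (q + 1):]"
    have poly_M: "poly M \<beta> = \<beta> ^ q + \<beta> - \<alpha> ^ (q + 1)" for \<beta> by (simp add: M_def poly_monom)
    have "degree (monom 1 1 - [:\<alpha> ^ (q + 1):]) \<le> 1"
      by (intro degree_diff_le) (auto simp: degree_monom_le)
    then have deg_M: "degree M = q"
      unfolding M_def diff_conv_add_uminus add.assoc
      using q_ge_2 by (subst degree_add_eq_left) (auto simp: degree_monom_eq)
    have "pderiv M = 1"
      using of_nat_q_eq_0[where 'r = "'f alg_closure"]
      by (simp add: M_def pderiv_diff pderiv_add pderiv_monom pderiv_pCons monom_0)
    moreover have "M \<noteq> 0" using deg_M q_ge_2 by auto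
    ultimately have card_M: "card {\<beta>. poly M \<beta> = 0} = q"
      using card_roots_separable[of M] deg_M by simp
    have eval_0: "curve_point.eval to_ac q \<alpha> \<beta> c = 0"
      and hom: "r \<alpha> (p + p') = r \<alpha> p + r \<alpha> p'" "r \<alpha> (p * p') = r \<alpha> p * r \<alpha> p'"
      and eval_eq: "curve_point.eval to_ac q \<alpha> \<beta> c = (\<Sum>j<q. r \<alpha> (c j) * \<beta> ^ j)"
      if "poly M \<beta> = 0" for \<beta> p p'
    proof -
      have curve: "\<beta> ^ q + \<beta> = \<alpha> ^ (q + 1)" using that by (simp add: poly_M)
      interpret E: curve_point to_ac q \<alpha> \<beta>
        using q_ge_2 curve by unfold_locales auto
      have rE: "r \<alpha> p = E.eval_poly p" for p by (simp add: r_def E.eval_poly_def)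
      show "r \<alpha> (p + p') = r \<alpha> p + r \<alpha> p'" "r \<alpha> (p * p') = r \<alpha> p * r \<alpha> p'"
        by (simp_all add: rE E.eval_poly_add E.eval_poly_mult)
      show "E.eval c = (\<Sum>j<q. r \<alpha> (c j) * \<beta> ^ j)" by (simp add: rE E.eval_def)
      obtain v where v: "v \<in> places K" "\<And>c. (\<And>j. c j \<in> poly_over K) \<Longrightarrow> self.eval c \<noteq> 0 \<Longrightarrow>
          0 \<le> v (self.eval c) \<and> (0 < v (self.eval c) \<longleftrightarrow> E.eval c = 0)"
        using place_at_geometric_point[OF P P_x curve n(2,1)] by blast
      have single: "self.eval (\<lambda>j. if j = 0 then p else 0) = poly p x"
        "E.eval (\<lambda>j. if j = 0 then p else 0) = E.eval_poly p" for p
        using q_ge_2 by (simp_all add: self.eval_single E.eval_single eval_poly_self)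
      have "0 \<le> v x"
        using v(2)[of "\<lambda>j. if j = 0 then [:0, 1:] else 0"] x_neq_0
        by (simp add: single poly_over_pCons poly_over_0 subfield_0 subfield_1 subfield_K)
      then have "v \<noteq> P" using P_x by auto
      then have "0 \<le> v f" using reg[OF v(1)] f0 by (simp add: ord_ge_def)
      moreover have "0 < v (poly h x)"
        using v(2)[of "\<lambda>j. if j = 0 then h else 0"] hK x_not_root[OF hK] \<alpha>
        by (simp add: single poly_over_0 subfield_K rE)
      ultimately have "0 < v (self.eval c)"
        using x_not_root[OF hK] f0 by (simp add: place_mult[OF v(1)] flip: c(2))
      then show "E.eval c = 0" using v(2)[OF c(1) nz] by simp
    qed
    \<comment> \<open>The homomorphism laws for \<open>r\<close> were derived inside a
      \<open>curve_point\<close>, so some point of the fibre is needed to release them.\<close>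
    have "\<exists>\<beta>. poly M \<beta> = 0" using alg_closed_imp_poly_has_root[of M] deg_M q_ge_2 by simp
    then have r_add: "r \<alpha> (p + p') = r \<alpha> p + r \<alpha> p'" and r_mult: "r \<alpha> (p * p') = r \<alpha> p * r \<alpha> p'" for p p'
      using hom by blast+
    define G where "G = (\<Sum>j<q. monom (r \<alpha> (c j)) j)"
    have G0: "G = 0"
    proof (rule ccontr)
      assume ne: "G \<noteq> 0"
      have "{\<beta>. poly M \<beta> = 0} \<subseteq> {\<beta>. poly G \<beta> = 0}"
        using eval_0 eval_eq by (auto simp: G_def poly_sum poly_monom)
      then have "q \<le> card {\<beta>. poly G \<beta> = 0}"
        unfolding card_M[symmetric] using ne by (intro card_mono poly_roots_finite) auto
      also have "\<dots> \<le> degree G" using ne by (rule card_poly_roots_bound)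
      also have "degree G \<le> q - 1"
        unfolding G_def by (intro degree_sum_le) (auto intro: order_trans[OF degree_monom_le])
      finally show False using q_ge_2 by simp
    qed
    have rc: "r \<alpha> (c j) = 0" if "j < q" for j
    proof -
      have "coeff G j = r \<alpha> (c j)" using that by (simp add: G_def coeff_sum)
      then show ?thesis using G0 by simp
    qed
    \<comment> \<open>A root polynomial \<open>m\<close> of least degree is, up to a constant, the
      minimal polynomial of \<alpha> over \<open>K\<close>. It divides \<open>h\<close> and all
      \<open>c j\<close>, and cancelling it contradicts the minimality of \<open>h\<close>, since a
      nonzero constant has no root.\<close>
    define root where "root = (\<lambda>p. p \<in> poly_over K \<and> p \<noteq> 0 \<and> r \<alpha> p = 0)"
    have "root h" using hK \<alpha> by (simp add: root_def)
    then obtain m where m: "root m" and m_min: "\<And>g. root g \<Longrightarrow> degree m \<le> degree g"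
      using ex_has_least_nat[of root h degree] by blast
    have m_dvd: "\<exists>d\<in>poly_over K. p = d * m" if p: "p \<in> poly_over K" "r \<alpha> p = 0" for p
    proof -
      obtain d s where ds: "d \<in> poly_over K" "s \<in> poly_over K" "p = d * m + s" "s = 0 \<or> degree s < degree m"
        using poly_over_division[OF subfield_K _ _ p(1), of m] m by (auto simp: root_def)
      have "r \<alpha> s = 0" using p(2) m unfolding ds(3) r_add r_mult by (simp add: root_def)
      then have "s = 0" using ds m_min[of s] by (cases "s = 0") (auto simp: root_def)
      then show ?thesis using ds by auto
    qed
    obtain h' where h': "h' \<in> poly_over K" "h = h' * m" using m_dvd[OF hK(1) \<alpha>] by auto
    have "\<forall>j. \<exists>d\<in>poly_over K. j < q \<longrightarrow> c j = d * m"
      using m_dvd[OF c(1) rc] poly_over_0[OF subfield_K] by metis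
    then obtain d where d: "\<And>j. d j \<in> poly_over K" "\<And>j. j < q \<Longrightarrow> c j = d j * m" by metis
    have mx: "poly m x \<noteq> 0" using m x_not_root by (simp add: root_def)
    have "poly m x * (poly h' x * f) = self.eval c" using c(2) by (simp add: h' mult_ac)
    also have "\<dots> = poly m x * self.eval d"
      using d(2) by (simp add: self.eval_def eval_poly_self sum_distrib_left mult_ac)
    finally have "poly h' x * f = self.eval d" using mx by simp
    then have "good h'" using h' d hK by (auto simp: good_def coord_ring_def)
    then have "degree h \<le> degree h'" by (rule min)
    moreover have "degree h = degree h' + degree m" using h' hK by (auto simp: degree_mult_eq)
    ultimately have "degree m = 0" by simp
    then obtain k where "m = [:k:]" by (metis degree_0_id)
    then show ?thesis using m by (simp add: root_def r_def map_poly_pCons)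
  qed
qed

end

end

section \<open>Discrepancies\<close>

lemma ord_ge_prime:
  assumes v: "v \<in> places K" and "ord_ge v 0 f" "ord_ge v 0 g" "ord_ge v 1 (f * g)"
  shows "ord_ge v 1 f \<or> ord_ge v 1 g"
  using assms place_mult[OF v, of f g] by (cases "f = 0 \<or> g = 0") (auto simp: ord_ge_def)

lemma ord_ge_power_1:
  assumes v: "v \<in> places K" and "ord_ge v 0 f" "ord_ge v 1 (f ^ n)"
  shows "ord_ge v 1 f"
  using assms(2-)
proof (cases "f = 0")
  case False
  then have "0 < int n * v f" using assms by (simp add: ord_ge_def place_power[OF v])
  then show ?thesis using assms False by (simp add: ord_ge_def zero_less_mult_iff)
qed simp

context hermitian_curve
begin

context
  fixes P Q :: "'f \<Rightarrow> int"
  assumes P: "P \<in> rational_points K" and P_x: "P x < 0"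
    and Q: "Q \<in> places K" and Q_x: "Q x > 0" and Q_y: "Q y > 0"
begin

lemma PQ_neq: "P \<noteq> Q"
  using P_x Q_x by auto

lemma P_place': "P \<in> places K"
  using P by (rule rational_point_place)

lemmas P_values = values_infinity[OF P_place' P_x]
lemmas Q_values = values_origin[OF Q Q_x Q_y]

lemma finite_place_values:
  assumes "v \<in> places K" "v \<noteq> P"
  shows "0 \<le> v x" "0 \<le> v y"
proof -
  show "0 \<le> v x" using infinity_unique[OF assms(1) _ P_place' P_x] assms(2) by force
  then show "0 \<le> v y" using y_integral assms by blast
qed

text \<open>A finite zero of \<open>y\<close> is also a zero of \<open>x\<close> by the curve
  equation, and only Q lies over the origin. So the divisor of \<open>y\<close> is
  \<open>(q + 1) (Q - P)\<close>, which makes \<open>y\<close> the means of shifting between P and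
  Q.\<close>

lemma y_unit:
  assumes v: "v \<in> places K" and "v \<noteq> P" "v \<noteq> Q"
  shows "v y = 0"
proof (rule ccontr)
  assume "v y \<noteq> 0"
  then have y: "v y > 0" using finite_place_values[OF assms(1,2)] by simp
  then have "ord_ge v 1 (y ^ q + y)"
    using q_ge_2 by (intro ord_ge_add[OF v] ord_ge_power[OF v]) (auto simp: ord_ge_def)
  then have "ord_ge v 1 x"
    unfolding curve_eq using finite_place_values[OF assms(1,2)]
    by (intro ord_ge_power_1[OF v, of x "q + 1"]) (auto simp: ord_ge_def)
  then have "v x > 0" using x_neq_0 by (simp add: ord_ge_def)
  then show False using origin_unique[OF v _ y Q Q_x Q_y] assms by simp
qed

text \<open>Multiplying by a power of \<open>y\<close> removes the pole at Q and leads into the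
  coordinate ring. The monomial that attains the minimum at P is one of those over which the minimum
  at Q is taken, whence the inequality there. Dividing the power of \<open>y\<close> out again makes
  the exponent \<open>j\<close> an arbitrary integer.\<close>

lemma pole_orders:
  assumes f: "f \<noteq> 0" and reg: "\<And>v. v \<in> places K \<Longrightarrow> v \<noteq> P \<Longrightarrow> v \<noteq> Q \<Longrightarrow> 0 \<le> v f"
  obtains i j :: int where "0 \<le> i" "i \<le> int q" "P f = - (int q * i + (int q + 1) * j)"
    "Q f \<le> i + (int q + 1) * j"
proof -
  \<comment> \<open>Each factor \<open>y\<close> contributes \<open>q + 1\<close>, so this many
    factors more than suffice.\<close>
  define N where "N = nat (- Q f)"
  define g where "g = y ^ N * f"
  have g0: "g \<noteq> 0" using f y_neq_0 by (simp add: g_def)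
  have vg: "v g = int N * v y + v f" if "v \<in> places K" for v
    using that f y_neq_0 by (simp add: g_def place_mult place_power)
  have "g \<in> coord_ring"
  proof (rule regular_imp_coord_ring[OF P P_x])
    fix v assume v: "v \<in> places K" "v \<noteq> P"
    have "0 \<le> v g"
    proof (cases "v = Q")
      case True
      have "int N * 1 \<le> int N * (int q + 1)" by (intro mult_left_mono) auto
      moreover have "- Q f \<le> int N" by (simp add: N_def)
      ultimately show ?thesis unfolding True vg[OF Q] Q_values(2) by linarith
    next
      case False
      then show ?thesis using vg[OF v(1)] y_unit[OF v False] reg[OF v False] by simp
    qed
    then show "ord_ge v 0 g" by (simp add: ord_ge_def)
  qed
  then obtain T where T: "finite T" "T \<noteq> {}" "T \<subseteq> {..q} \<times> UNIV"
      "\<And>v. v \<in> places K \<Longrightarrow> inj_on (\<lambda>s. int (fst s) * v x + int (snd s) * v y) ({..q} \<times> UNIV) \<Longrightarrow>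
       v g = Min ((\<lambda>s. int (fst s) * v x + int (snd s) * v y) ` T)"
    by (rule coord_ring_values[OF _ g0]) blast
  have Pg: "P g = Min ((\<lambda>s. int (fst s) * P x + int (snd s) * P y) ` T)"
    using T(4)[OF P_place'] inj_infinity P_values by simp
  have "\<dots> \<in> (\<lambda>s. int (fst s) * P x + int (snd s) * P y) ` T"
    using T by (intro Min_in) auto
  then obtain s where s: "s \<in> T" "P g = int (fst s) * P x + int (snd s) * P y" using Pg by auto
  have "Q g = Min ((\<lambda>s. int (fst s) * Q x + int (snd s) * Q y) ` T)"
    using T(4)[OF Q] inj_origin Q_values by simp
  also have "\<dots> \<le> int (fst s) * Q x + int (snd s) * Q y"
    using T s by (intro Min_le) auto
  finally have Qg: "Q g \<le> int (fst s) * Q x + int (snd s) * Q y" .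
  show thesis
  proof (rule that[of "int (fst s)" "int (snd s) - int N"])
    show "int (fst s) \<le> int q" using s T by auto
    show "P f = - (int q * int (fst s) + (int q + 1) * (int (snd s) - int N))"
      using s(2) unfolding vg[OF P_place'] P_values by (simp add: algebra_simps)
    show "Q f \<le> int (fst s) + (int q + 1) * (int (snd s) - int N)"
      using Qg unfolding vg[OF Q] Q_values by (simp add: algebra_simps)
  qed simp
qed

definition L2 :: "int \<Rightarrow> int \<Rightarrow> 'f set" where
  "L2 i j = L_space K (\<lambda>v. i * pt P v + j * pt Q v)"

lemma L2_iff:
  "f \<in> L2 i j \<longleftrightarrow> f = 0 \<or> (- i \<le> P f \<and> - j \<le> Q f \<and> (\<forall>v\<in>places K. v \<noteq> P \<longrightarrow> v \<noteq> Q \<longrightarrow> 0 \<le> v f))"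
  using PQ_neq P_place' Q
  by (auto simp: L2_def L_space_def principal_def pt_def)

text \<open>The space shrinks iff some function has pole order exactly \<open>i\<close> at P. The
  leading monomial of such a function satisfies the same bound at Q, and conversely that monomial,
  possibly with a negative power of \<open>y\<close>, is itself in the space.\<close>

lemma L2_step:
  "L2 i j = L2 (i - 1) j \<longleftrightarrow>
    \<not> (\<exists>k l. 0 \<le> k \<and> k \<le> int q \<and> int q * k + (int q + 1) * l = i \<and> - j \<le> k + (int q + 1) * l)"
    (is "?L \<longleftrightarrow> \<not> ?R")
proof -
  have "f \<in> L2 (i - 1) j \<longleftrightarrow> f \<in> L2 i j \<and> \<not> (f \<noteq> 0 \<and> P f = - i)" for f
    by (cases "f = 0") (auto simp: L2_iff)
  then have "?L \<longleftrightarrow> \<not> (\<exists>f. f \<in> L2 i j \<and> f \<noteq> 0 \<and> P f = - i)"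
    by blast
  moreover have "(\<exists>f. f \<in> L2 i j \<and> f \<noteq> 0 \<and> P f = - i) \<longleftrightarrow> ?R"
  proof
    assume "\<exists>f. f \<in> L2 i j \<and> f \<noteq> 0 \<and> P f = - i"
    then obtain f where f: "f \<in> L2 i j" "f \<noteq> 0" "P f = - i" by blast
    obtain k l where "0 \<le> k" "k \<le> int q" "P f = - (int q * k + (int q + 1) * l)" "Q f \<le> k + (int q + 1) * l"
      using pole_orders[OF f(2)] f(1,2) by (auto simp: L2_iff)
    then show ?R using f by (intro exI[of _ k] exI[of _ l]) (auto simp: L2_iff)
  next
    assume ?R
    then obtain k l where kl: "0 \<le> k" "k \<le> int q" "int q * k + (int q + 1) * l = i" "- j \<le> k + (int q + 1) * l"
      by blast
    define f where "f = x ^ nat k * y powi l"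
    have f0: "f \<noteq> 0" using x_neq_0 y_neq_0 by (simp add: f_def)
    have vf: "v f = k * v x + l * v y" if "v \<in> places K" for v
      using that kl(1) x_neq_0 y_neq_0 by (simp add: f_def place_mult place_power place_power_int)
    have "0 \<le> v f" if "v \<in> places K" "v \<noteq> P" "v \<noteq> Q" for v
      using that kl(1) finite_place_values(1)[OF that(1,2)] by (simp add: vf y_unit)
    then have "f \<in> L2 i j"
      unfolding L2_iff vf[OF P_place'] vf[OF Q] P_values Q_values
      using kl by (auto simp: algebra_simps)
    moreover have "P f = - i"
      unfolding vf[OF P_place'] P_values using kl by (simp add: algebra_simps)
    ultimately show "\<exists>f. f \<in> L2 i j \<and> f \<noteq> 0 \<and> P f = - i" using f0 by blast
  qed
  ultimately show ?thesis by simp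
qed

text \<open>The first condition supplies a monomial of pole order \<open>i\<close> at P meeting the
  bound \<open>- j\<close> at Q; the second says that no such monomial meets the bound
  \<open>- j + 1\<close>. Together they force equality. Conversely the pole order at P determines
  the monomial, so no other one can spoil the second condition.\<close>

lemma discrepancy_iff:
  "discrepancy K P Q (\<lambda>v. i * pt P v + j * pt Q v) \<longleftrightarrow>
    (\<exists>k l. 0 \<le> k \<and> k \<le> int q \<and> i = int q * k + (int q + 1) * l \<and> j = - (k + (int q + 1) * l))"
    (is "_ \<longleftrightarrow> ?R")
proof -
  have eqs: "(\<lambda>v. i * pt P v + j * pt Q v - pt P v) = (\<lambda>v. (i - 1) * pt P v + j * pt Q v)"
    "(\<lambda>v. i * pt P v + j * pt Q v - pt Q v) = (\<lambda>v. i * pt P v + (j - 1) * pt Q v)"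
    "(\<lambda>v. i * pt P v + j * pt Q v - pt Q v - pt P v) = (\<lambda>v. (i - 1) * pt P v + (j - 1) * pt Q v)"
    by (auto simp: algebra_simps)
  have "discrepancy K P Q (\<lambda>v. i * pt P v + j * pt Q v) \<longleftrightarrow>
      L2 i j \<noteq> L2 (i - 1) j \<and> L2 i (j - 1) = L2 (i - 1) (j - 1)"
    unfolding discrepancy_def eqs L2_def ..
  also have "\<dots> \<longleftrightarrow> ?R"
  proof
    assume *: "L2 i j \<noteq> L2 (i - 1) j \<and> L2 i (j - 1) = L2 (i - 1) (j - 1)"
    then obtain k l where kl: "0 \<le> k" "k \<le> int q" "int q * k + (int q + 1) * l = i" "- j \<le> k + (int q + 1) * l"
      unfolding L2_step by blast
    then have "\<not> - (j - 1) \<le> k + (int q + 1) * l" using * unfolding L2_step by blast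
    then have "j = - (k + (int q + 1) * l)" using kl by linarith
    then show ?R using kl by blast
  next
    assume ?R
    then obtain k' l' where kl': "0 \<le> k'" "k' \<le> int q" "i = int q * k' + (int q + 1) * l'" "j = - (k' + (int q + 1) * l')"
      by blast
    have False if kl: "0 \<le> k" "k \<le> int q" "int q * k + (int q + 1) * l = i" "- (j - 1) \<le> k + (int q + 1) * l" for k l
    proof -
      have "(int q + 1) * (k + l - k' - l') = k - k'" using kl(3) kl'(3) by (simp add: algebra_simps)
      moreover from this have "k + l - k' - l' = 0" by (rule small_multiple_eq_0) (use kl kl' in auto)
      ultimately have "k = k'" "l = l'" by auto
      then show False using kl(4) kl'(4) by simp
    qed
    moreover have "- j \<le> k' + (int q + 1) * l'" using kl'(4) by simp
    ultimately show "L2 i j \<noteq> L2 (i - 1) j \<and> L2 i (j - 1) = L2 (i - 1) (j - 1)"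
      unfolding L2_step using kl' by blast
  qed
  finally show ?thesis .
qed

lemma pt_divisor: "(\<lambda>v. i * pt P v + j * pt Q v) \<in> divisors K"
proof -
  have "{v. i * pt P v + j * pt Q v \<noteq> 0} \<subseteq> {P, Q}" by (auto simp: pt_def)
  then show ?thesis using P_place' Q unfolding divisors_def by (auto intro: finite_subset)
qed

lemma principal_y: "principal K y = (\<lambda>v. (int q + 1) * pt Q v - (int q + 1) * pt P v)"
proof
  fix v show "principal K y v = (int q + 1) * pt Q v - (int q + 1) * pt P v"
    using P_place' Q PQ_neq P_values(2) Q_values(2) y_unit[of v]
    by (cases "v = P"; cases "v = Q") (simp_all add: principal_def pt_def)
qed

lemma principal_y_powi: "principal K (y powi l) v = l * ((int q + 1) * pt Q v - (int q + 1) * pt P v)"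
  using fun_cong[OF principal_y, of v] y_neq_0
  by (auto simp: principal_def place_power_int split: if_splits)

lemma lin_equiv_shift:
  "(\<lambda>v. i * pt P v + j * pt Q v, \<lambda>v. (i + (int q + 1) * l) * pt P v + (j - (int q + 1) * l) * pt Q v) \<in> lin_equiv K"
    (is "(?A, ?B) \<in> _")
proof -
  have "?A \<in> divisors K" "?B \<in> divisors K" by (rule pt_divisor)+
  moreover have "?A v - ?B v = principal K (y powi l) v" for v
    by (simp add: principal_y_powi algebra_simps)
  moreover have "y powi l \<noteq> 0" using y_neq_0 by simp
  ultimately show ?thesis unfolding lin_equiv_def by blast
qed

text \<open>A function \<open>f\<close> realizing the equivalence has \<open>P f = q (i - j)\<close>
  and \<open>Q f = - (i - j)\<close>. Adding the two relations of its leading monomial eliminates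
  \<open>l\<close> and leaves \<open>(q - 1) (i - j) \<le> - (q - 1) k\<close>. One inequality is
  enough, as equivalence is symmetric.\<close>

lemma lin_equiv_imp_le:
  assumes "(\<lambda>v. int q * i * pt P v + (- i) * pt Q v, \<lambda>v. int q * j * pt P v + (- j) * pt Q v) \<in> lin_equiv K"
  shows "i \<le> j"
proof -
  obtain f where f: "f \<noteq> 0"
    "\<And>v. (int q * i * pt P v + (- i) * pt Q v) - (int q * j * pt P v + (- j) * pt Q v) = principal K f v"
    using assms by (auto simp: lin_equiv_def)
  have Pf: "P f = int q * (i - j)" using f(2)[of P] P_place' PQ_neq by (simp add: principal_def pt_def algebra_simps)
  have Qf: "Q f = - (i - j)" using f(2)[of Q] Q PQ_neq by (simp add: principal_def pt_def)
  have reg: "0 \<le> v f" if "v \<in> places K" "v \<noteq> P" "v \<noteq> Q" for v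
    using f(2)[of v] that by (simp add: principal_def pt_def)
  obtain k l where kl: "0 \<le> k" "P f = - (int q * k + (int q + 1) * l)" "Q f \<le> k + (int q + 1) * l"
    using pole_orders[OF f(1)] reg by metis
  have "(int q - 1) * (i - j) \<le> (int q - 1) * (- k)"
    using kl(2,3) Pf Qf by (simp add: algebra_simps)
  then have "i - j \<le> - k" using q_ge_2 by (subst (asm) mult_le_cancel_left_pos) auto
  then show ?thesis using kl(1) by simp
qed

end

end

section \<open>Lines and changes of coordinates\<close>

text \<open>
  The intersection divisor of a line is unchanged when \<open>(x : y : 1)\<close> is replaced by a
  \<open>K\<close>-linear transform \<open>(x' : y' : 1)\<close>.
\<close>

definition same_lines :: "'f::field set \<Rightarrow> 'f \<Rightarrow> 'f \<Rightarrow> 'f \<Rightarrow> 'f \<Rightarrow> bool" where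
  "same_lines K x y x' y' \<longleftrightarrow> (\<forall>a\<in>K. \<forall>b\<in>K. \<forall>c\<in>K. (a, b, c) \<noteq> (0, 0, 0) \<longrightarrow>
     (\<exists>a'\<in>K. \<exists>b'\<in>K. \<exists>c'\<in>K. (a', b', c') \<noteq> (0, 0, 0) \<and>
        line_divisor K x y a b c = line_divisor K x' y' a' b' c'))"

lemma same_lines_refl: "same_lines K x y x y"
  unfolding same_lines_def by blast

lemma same_lines_trans: "same_lines K x y x' y' \<Longrightarrow> same_lines K x' y' x'' y'' \<Longrightarrow> same_lines K x y x'' y''"
  unfolding same_lines_def by metis

lemma poly_over_pcompose:
  assumes K: "is_subfield K" and "p \<in> poly_over K" "r \<in> poly_over K"
  shows "pcompose p r \<in> poly_over K"
  using assms(2)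
proof (induction p)
  case (pCons a p)
  have "a \<in> K" using poly_overD[OF pCons.prems, of 0] by simp
  moreover have "p \<in> poly_over K" using pCons.prems by (auto simp: poly_over_def coeff_pCons split: nat.splits)
  ultimately show ?case
    unfolding pcompose_pCons using pCons.IH assms(3)
    by (intro poly_over_add[OF K] poly_over_mult[OF K] poly_over_pCons[OF K] poly_over_0[OF K]) auto
qed (simp add: poly_over_0[OF K])

text \<open>The powers of \<open>t\<close> have pairwise distinct values, so no polynomial relation
  can hold. This supplies the transcendence of the inverted coordinate.\<close>

lemma place_nonzero_imp_transcendental:
  assumes K: "is_subfield K" and v: "v \<in> places K" and t: "t \<noteq> 0" "v t \<noteq> 0"
    and p: "p \<in> poly_over K" "poly p t = 0"
  shows "p = 0"
proof (rule ccontr)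
  assume p0: "p \<noteq> 0"
  define I where "I = {i. i \<le> degree p \<and> coeff p i \<noteq> 0}"
  have "poly p t = (\<Sum>i\<le>degree p. coeff p i * t ^ i)" by (simp add: poly_altdef)
  also have "\<dots> = (\<Sum>i\<in>I. coeff p i * t ^ i)"
    unfolding I_def by (intro sum.mono_neutral_right) auto
  finally have "(\<Sum>i\<in>I. coeff p i * t ^ i) = 0" using p by simp
  moreover have "degree p \<in> I" using p0 by (simp add: I_def)
  then have "I \<noteq> {}" by blast
  moreover have "v (coeff p i * t ^ i) = int i * v t" if "i \<in> I" for i
    using that p t by (simp add: I_def place_mult[OF v] place_power[OF v] place_const[OF v] poly_overD)
  then have "inj_on (\<lambda>i. v (coeff p i * t ^ i)) I" using t by (simp add: inj_on_def)
  moreover have "finite I" "\<And>i. i \<in> I \<Longrightarrow> coeff p i * t ^ i \<noteq> 0" using t by (auto simp: I_def)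
  ultimately show False
    using place_sum_distinct[OF v, of I "\<lambda>i. coeff p i * t ^ i"] by simp
qed

context hermitian_curve
begin

text \<open>The minimum is never positive because of the coordinate 1. In this range it is described
  by \<open>ord_ge\<close>, which is compatible with sums and thus with affine changes of
  coordinates.\<close>

lemma Min_coordinates_ge:
  assumes "v \<in> places K" "m \<le> 0"
  shows "m \<le> Min {v x, v y, v 1} \<longleftrightarrow> ord_ge v m x \<and> ord_ge v m y"
  using assms x_neq_0 y_neq_0 by (simp add: ord_ge_def place_one)

text \<open>The automorphism fixing infinity that moves the rational point (\<alpha>, \<beta>) to
  the origin. Differentiating the curve equation gives slope \<alpha>^q there, so \<open>y'\<close>
  is the equation of the tangent line.\<close>

lemma translate:
  assumes \<alpha>: "\<alpha> \<in> K" and \<beta>: "\<beta> \<in> K" and point: "\<beta> ^ q + \<beta> = \<alpha> ^ (q + 1)"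
  defines "x' \<equiv> x - \<alpha>" and "y' \<equiv> y - \<beta> - \<alpha> ^ q * (x - \<alpha>)"
  shows "hermitian_curve q K x' y'" "same_lines K x y x' y'"
proof -
  have \<alpha>q: "\<alpha> ^ q \<in> K" using \<alpha> by (rule subfield_power[OF subfield_K])
  have x: "x = x' + \<alpha>" and y: "y = y' + \<beta> + \<alpha> ^ q * x'" by (simp_all add: x'_def y'_def)
  show herm: "hermitian_curve q K x' y'"
  proof
    \<comment> \<open>Rationality enters here: the \<open>q\<close>-th power turns the coefficient
      \<alpha>^q back into \<alpha>, so the mixed terms cancel.\<close>
    have "y' ^ q = y ^ q - \<beta> ^ q - \<alpha> * x' ^ q"
      unfolding y'_def frob_diff power_mult_distrib const_power_q2[OF \<alpha>] by (simp add: frob_diff x'_def)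
    then have "y' ^ q + y' = (y ^ q + y) - (\<beta> ^ q + \<beta>) - \<alpha> * x' ^ q - \<alpha> ^ q * x'"
      by (simp add: y'_def x'_def)
    also have "y ^ q + y = (x' ^ q + \<alpha> ^ q) * (x' + \<alpha>)"
      unfolding curve_eq power_add frob_add[symmetric] by (simp add: x'_def)
    finally show "y' ^ q + y' = x' ^ (q + 1)" unfolding point by (simp add: algebra_simps)
  next
    fix p assume p: "set (coeffs p) \<subseteq> K" "poly p x' = 0"
    then have "p \<in> poly_over K" by (simp add: poly_over_iff_coeffs[OF subfield_K])
    then have "pcompose p [:- \<alpha>, 1:] \<in> poly_over K"
      using \<alpha> by (intro poly_over_pcompose[OF subfield_K])
        (auto intro!: poly_over_pCons[OF subfield_K] poly_over_0[OF subfield_K] subfield_uminus[OF subfield_K]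
          subfield_1[OF subfield_K])
    moreover have "poly (pcompose p [:- \<alpha>, 1:]) x = 0" using p(2) by (simp add: poly_pcompose x'_def)
    ultimately have "pcompose p [:- \<alpha>, 1:] = 0" using x_not_root by blast
    then show "p = 0" by (rule pcompose_eq_0) simp
  next
    fix S assume S: "is_subfield S" "K \<subseteq> S" "x' \<in> S" "y' \<in> S"
    have "x \<in> S" unfolding x using S \<alpha> by (auto intro: subfield_add[OF S(1)])
    moreover have "y \<in> S" unfolding y using S \<beta> \<alpha>q
      by (intro subfield_add[OF S(1)] subfield_mult[OF S(1)]) auto
    ultimately show "S = UNIV" using generated S by blast
  qed (use subfield_K finite_K card_K in auto)
  interpret T: hermitian_curve q K x' y' by (rule herm)
  have Min_eq: "Min {v x, v y, v 1} = Min {v x', v y', v 1}" if v: "v \<in> places K" for v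
  proof -
    have shift: "ord_ge v m x \<and> ord_ge v m y \<longleftrightarrow> ord_ge v m x' \<and> ord_ge v m y'" if m: "m \<le> 0" for m
    proof -
      have c: "ord_ge v m a" if "a \<in> K" for a
        using ord_ge_mono[OF ord_ge_const[OF v that] m] .
      have s: "ord_ge v m (a * f)" if "a \<in> K" "ord_ge v m f" for a f
        using ord_ge_mult[OF v ord_ge_const[OF v that(1)] that(2)] by simp
      show ?thesis
      proof (intro iffI conjI; elim conjE)
        assume *: "ord_ge v m x" "ord_ge v m y"
        show x': "ord_ge v m x'" unfolding x'_def using * c \<alpha> by (intro ord_ge_diff[OF v])
        show "ord_ge v m y'" unfolding y'_def x'_def[symmetric] using * c s \<beta> \<alpha>q x' by (intro ord_ge_diff[OF v])
      next
        assume *: "ord_ge v m x'" "ord_ge v m y'"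
        show "ord_ge v m x" unfolding x using * c \<alpha> by (intro ord_ge_add[OF v])
        show "ord_ge v m y" unfolding y using * c s \<beta> \<alpha>q by (intro ord_ge_add[OF v])
      qed
    qed
    have le0: "Min {v x, v y, v 1} \<le> 0" "Min {v x', v y', v 1} \<le> 0"
      by (auto simp: place_one[OF v])
    show ?thesis
    proof (rule antisym)
      show "Min {v x, v y, v 1} \<le> Min {v x', v y', v 1}"
        using T.Min_coordinates_ge[OF v le0(1)] Min_coordinates_ge[OF v le0(1)] shift[OF le0(1)] by simp
      show "Min {v x', v y', v 1} \<le> Min {v x, v y, v 1}"
        using T.Min_coordinates_ge[OF v le0(2)] Min_coordinates_ge[OF v le0(2)] shift[OF le0(2)] by simp
    qed
  qed
  show "same_lines K x y x' y'"
    unfolding same_lines_def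
  proof (intro ballI impI)
    fix a b c assume K: "a \<in> K" "b \<in> K" "c \<in> K" and nz: "(a, b, c) \<noteq> (0, 0, 0)"
    define a' where "a' = a + b * \<alpha> ^ q"
    define c' where "c' = a * \<alpha> + b * \<beta> + c"
    have form: "a * x + b * y + c = a' * x' + b * y' + c'"
      unfolding x y a'_def c'_def by (simp add: algebra_simps)
    have "a' \<in> K" "c' \<in> K" unfolding a'_def c'_def
      using K \<alpha> \<beta> \<alpha>q by (auto intro!: subfield_add[OF subfield_K] subfield_mult[OF subfield_K])
    moreover have "(a', b, c') \<noteq> (0, 0, 0)" using nz by (auto simp: a'_def c'_def)
    moreover have "line_divisor K x y a b c = line_divisor K x' y' a' b c'"
      unfolding line_divisor_def form using Min_eq by auto
    ultimately show "\<exists>a'\<in>K. \<exists>b'\<in>K. \<exists>c'\<in>K. (a', b', c') \<noteq> (0, 0, 0) \<and>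
        line_divisor K x y a b c = line_divisor K x' y' a' b' c'" using K by blast
  qed
qed

text \<open>A normal form in the indices 0 and 1, both below \<open>q\<close>. Without this, the
  dummy value at 0 would corrupt the line divisor.\<close>

lemma line_nonzero:
  assumes P: "P \<in> rational_points K" and P_x: "P x < 0"
    and K: "a \<in> K" "b \<in> K" "c \<in> K" and nz: "(a, b, c) \<noteq> (0, 0, 0)"
  shows "a * x + b * y + c \<noteq> 0"
proof
  assume 0: "a * x + b * y + c = 0"
  define d where "d = (\<lambda>j. (if j = (0::nat) then [:c, a:] else 0) + (if j = 1 then [:b:] else 0))"
  have "self.eval d = 0"
    unfolding d_def self.eval_add using q_ge_2 0
    by (simp add: self.eval_single eval_poly_self algebra_simps)
  moreover have "d j \<in> poly_over K" for j
    unfolding d_def using K by (auto intro!: poly_over_add[OF subfield_K] poly_over_pCons[OF subfield_K] poly_over_0[OF subfield_K])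
  ultimately have "d 0 = 0" "d 1 = 0"
    using normal_form_zero[OF P P_x, of d] q_ge_2 by auto
  then show False using nz by (auto simp: d_def)
qed

text \<open>Exchanging the last two projective coordinates preserves the homogenized equation and
  swaps the origin with the point at infinity; on lines it swaps \<open>b\<close> and
  \<open>c\<close>.\<close>

lemma invert:
  assumes P: "P \<in> rational_points K" and P_x: "P x > 0" and P_y: "P y > 0"
  defines "x' \<equiv> x / y" and "y' \<equiv> 1 / y"
  shows "hermitian_curve q K x' y'" "P x' < 0" "same_lines K x y x' y'"
proof -
  have P_place: "P \<in> places K" using P by (rule rational_point_place)
  show P_x': "P x' < 0"
    unfolding x'_def using values_origin[OF P_place P_x P_y] q_ge_2 x_neq_0 y_neq_0
    by (simp add: place_divide[OF P_place])
  have x'0: "x' \<noteq> 0" using x_neq_0 y_neq_0 by (simp add: x'_def)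
  show herm: "hermitian_curve q K x' y'"
  proof
    have "y' ^ q + y' = (y ^ q + y) / y ^ (q + 1)"
      using y_neq_0 by (simp add: y'_def field_simps)
    also have "\<dots> = x' ^ (q + 1)" unfolding curve_eq x'_def power_divide ..
    finally show "y' ^ q + y' = x' ^ (q + 1)" .
  next
    fix p assume p: "set (coeffs p) \<subseteq> K" "poly p x' = 0"
    then show "p = 0"
      using place_nonzero_imp_transcendental[OF subfield_K P_place x'0] P_x'
      by (simp add: poly_over_iff_coeffs[OF subfield_K])
  next
    fix S assume S: "is_subfield S" "K \<subseteq> S" "x' \<in> S" "y' \<in> S"
    have "inverse y' \<in> S" using subfield_inverse[OF S(1,4)] .
    moreover have "inverse y' = y" by (simp add: y'_def)
    ultimately have y: "y \<in> S" by simp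
    have "x' * y \<in> S" using subfield_mult[OF S(1,3) y] .
    moreover have "x' * y = x" using y_neq_0 by (simp add: x'_def)
    ultimately show "S = UNIV" using generated S y by auto
  qed (use subfield_K finite_K card_K in auto)
  interpret T: hermitian_curve q K x' y' by (rule herm)
  show "same_lines K x y x' y'"
    unfolding same_lines_def
  proof (intro ballI impI)
    fix a b c assume K: "a \<in> K" "b \<in> K" "c \<in> K" and nz: "(a, b, c) \<noteq> (0, 0, 0)"
    have nz': "(a, c, b) \<noteq> (0, 0, 0)" using nz by auto
    have form: "a * x + b * y + c = y * (a * x' + c * y' + b)"
      using y_neq_0 by (simp add: x'_def y'_def field_simps)
    have form_nz: "a * x' + c * y' + b \<noteq> 0"
      using T.line_nonzero[OF P P_x' K(1,3,2) nz'] .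
    have "v (a * x + b * y + c) - Min {v x, v y, v 1} = v (a * x' + c * y' + b) - Min {v x', v y', v 1}"
      if v: "v \<in> places K" for v
    proof -
      have "v x' = v x - v y" "v y' = - v y"
        using x_neq_0 y_neq_0 by (simp_all add: x'_def y'_def place_divide[OF v] place_one[OF v])
      then show ?thesis
        unfolding form place_mult[OF v y_neq_0 form_nz] by (simp add: place_one[OF v] min_def)
    qed
    then have "line_divisor K x y a b c = line_divisor K x' y' a c b"
      unfolding line_divisor_def by auto
    then show "\<exists>a'\<in>K. \<exists>b'\<in>K. \<exists>c'\<in>K. (a', b', c') \<noteq> (0, 0, 0) \<and>
        line_divisor K x y a b c = line_divisor K x' y' a' b' c'" using K nz' by blast
  qed
qed

end

lemma divisor_class_eq_iff:
  "A \<in> divisors K \<Longrightarrow> B \<in> divisors K \<Longrightarrow> divisor_class K A = divisor_class K B \<longleftrightarrow> (A, B) \<in> lin_equiv K"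
  unfolding divisor_class_def by (rule eq_equiv_class_iff[OF equiv_lin_equiv])

section \<open>Rational points and zeros of lines\<close>

context hermitian_curve
begin

text \<open>The residues satisfy the curve equation: its defect is a constant of positive value,
  hence zero.\<close>

lemma point_on_curve:
  assumes v: "v \<in> places K" and \<alpha>: "\<alpha> \<in> K" "ord_ge v 1 (x - \<alpha>)" and \<beta>: "\<beta> \<in> K" "ord_ge v 1 (y - \<beta>)"
  shows "\<beta> ^ q + \<beta> = \<alpha> ^ (q + 1)"
proof -
  define e where "e = \<beta> ^ q + \<beta> - \<alpha> ^ (q + 1)"
  have e: "e \<in> K" unfolding e_def using \<alpha> \<beta>
    by (intro subfield_diff[OF subfield_K] subfield_add[OF subfield_K] subfield_power[OF subfield_K])
  have q: "q > 0" using q_ge_2 by simp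
  have x: "ord_ge v 0 x"
    using ord_ge_add[OF v ord_ge_mono[OF \<alpha>(2)] ord_ge_const[OF v \<alpha>(1)]] by simp
  have "e = x ^ q * (x - \<alpha>) + \<alpha> * (x - \<alpha>) ^ q - (y - \<beta>) ^ q - (y - \<beta>)"
    using curve_eq by (simp add: e_def frob_diff algebra_simps)
  moreover have "ord_ge v (0 + 1) (x ^ q * (x - \<alpha>))"
    using x \<alpha> q by (intro ord_ge_mult[OF v] ord_ge_power[OF v]) auto
  moreover have "ord_ge v (0 + 1) (\<alpha> * (x - \<alpha>) ^ q)"
    using \<alpha> q by (intro ord_ge_mult[OF v] ord_ge_power[OF v] ord_ge_const[OF v]) auto
  moreover have "ord_ge v 1 ((y - \<beta>) ^ q)" using \<beta> q by (intro ord_ge_power[OF v]) auto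
  ultimately have "ord_ge v 1 e" using \<beta> by (auto intro!: ord_ge_diff[OF v] ord_ge_add[OF v])
  then have "e = 0" using place_const[OF v e] by (simp add: ord_ge_def)
  then show ?thesis by (simp add: e_def)
qed

lemma move_to_origin:
  assumes v: "v \<in> places K" and \<alpha>: "\<alpha> \<in> K" "ord_ge v 1 (x - \<alpha>)" and \<beta>: "\<beta> \<in> K" "ord_ge v 1 (y - \<beta>)"
  defines "x' \<equiv> x - \<alpha>" and "y' \<equiv> y - \<beta> - \<alpha> ^ q * (x - \<alpha>)"
  shows "hermitian_curve q K x' y'" "same_lines K x y x' y'" "0 < v x'" "0 < v y'"
proof -
  note T = translate[OF \<alpha>(1) \<beta>(1) point_on_curve[OF v \<alpha> \<beta>], folded x'_def y'_def]
  show "hermitian_curve q K x' y'" "same_lines K x y x' y'" using T by (simp_all add: x'_def y'_def)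
  interpret T: hermitian_curve q K x' y' by fact
  show "0 < v x'" using \<alpha> T.x_neq_0 by (simp add: ord_ge_def x'_def)
  have "ord_ge v (0 + 1) (\<alpha> ^ q * (x - \<alpha>))"
    using \<alpha> by (intro ord_ge_mult[OF v] ord_ge_const[OF v] subfield_power[OF subfield_K])
  then have "ord_ge v 1 y'" unfolding y'_def using ord_ge_diff[OF v \<beta>(2)] by simp
  then show "0 < v y'" using T.y_neq_0 by (simp add: ord_ge_def)
qed

lemma rational_place_unique:
  assumes v: "v \<in> places K" "ord_ge v 1 (x - \<alpha>)" "ord_ge v 1 (y - \<beta>)"
    and w: "w \<in> places K" "ord_ge w 1 (x - \<alpha>)" "ord_ge w 1 (y - \<beta>)"
    and K: "\<alpha> \<in> K" "\<beta> \<in> K"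
  shows "v = w"
proof -
  note Tv = move_to_origin[OF v(1) K(1) v(2) K(2) v(3)]
  note Tw = move_to_origin[OF w(1) K(1) w(2) K(2) w(3)]
  show ?thesis using hermitian_curve.origin_unique[OF Tv(1) v(1) Tv(3,4) w(1) Tw(3,4)] .
qed

text \<open>\<open>f ^ q ^ 2 - f\<close> is the product of all \<open>f - a\<close> with
  \<open>a\<close> in \<open>K\<close>, and one factor must lie in the prime ideal.\<close>

lemma rational_residue:
  assumes v: "v \<in> places K" and f: "ord_ge v 0 f" "ord_ge v 1 (f ^ q ^ 2 - f)"
  obtains a where "a \<in> K" "ord_ge v 1 (f - a)"
proof -
  have "ord_ge v 1 (\<Prod>a\<in>K. f - a)"
    using f finite_subfield_prod_diff[OF subfield_K finite_K, of f] by (simp add: card_K)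
  then show thesis
    using ord_ge_prod_1[OF v finite_K, of "\<lambda>a. f - a"] that f ord_ge_diff[OF v f(1) ord_ge_const[OF v]] by blast
qed

text \<open>A place may have a residue field larger than \<open>K\<close>, but at a zero of a line
  the residues of \<open>x\<close> and \<open>y\<close> are fixed by the \<open>q ^ 2\<close>-th
  power. This bounds the zeros by \<open>K \<times> K\<close> and so makes the line divisor
  finite.\<close>

lemma line_zero_rational:
  assumes v: "v \<in> places K" and xy: "ord_ge v 0 x" "ord_ge v 0 y"
    and K: "a \<in> K" "b \<in> K" "c \<in> K" and nz: "(a, b) \<noteq> (0, 0)"
    and line: "ord_ge v 1 (a * x + b * y + c)"
  obtains \<alpha> \<beta> where "\<alpha> \<in> K" "\<beta> \<in> K" "ord_ge v 1 (x - \<alpha>)" "ord_ge v 1 (y - \<beta>)"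
proof -
  have q: "q > 0" using q_ge_2 by simp
  have scale: "ord_ge v 1 (k * f)" if "k \<in> K" "ord_ge v 1 f" for k f
    using ord_ge_mult[OF v ord_ge_const[OF v that(1)] that(2)] by simp
  \<comment> \<open>The shift \<open>k\<close> centres \<open>x\<close>: on a vertical line
    \<open>x - k\<close> vanishes at the place, otherwise it absorbs the linear terms and leaves a
    pure norm equation.\<close>
  obtain k where k: "k \<in> K" "ord_ge v 1 ((x - k) ^ q ^ 2 - (x - k))"
  proof (cases "b = 0")
    case True
    then have a: "a \<noteq> 0" using nz by simp
    have "x - - (c / a) = inverse a * (a * x + b * y + c)" using a True by (simp add: field_simps)
    then have s: "ord_ge v 1 (x - - (c / a))"
      using scale[OF subfield_inverse[OF subfield_K K(1)] line] by simp
    show thesis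
    proof (rule that)
      show "- (c / a) \<in> K" using K by (intro subfield_uminus[OF subfield_K] subfield_divide[OF subfield_K])
      show "ord_ge v 1 ((x - - (c / a)) ^ q ^ 2 - (x - - (c / a)))"
        using ord_ge_diff[OF v ord_ge_power[OF v s] s] q by simp
    qed
  next
    case b: False
    define m where "m = - (a / b)"
    define n where "n = - (c / b)"
    define N where "N = y - m * x - n"
    define s where "s = x - m ^ q"
    define e where "e = m ^ (q + 1) + n ^ q + n"
    have mn: "m \<in> K" "n \<in> K" unfolding m_def n_def
      using K by (auto intro!: subfield_uminus[OF subfield_K] subfield_divide[OF subfield_K])
    have mq: "m ^ q \<in> K" using mn by (intro subfield_power[OF subfield_K])
    have e: "e ^ q = e"
      unfolding e_def frob_add using const_power_q2[OF mn(1)] const_power_q2[OF mn(2)]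
      by (simp add: power_mult_distrib)
    have "N = inverse b * (a * x + b * y + c)" using b by (simp add: N_def m_def n_def field_simps)
    then have N: "ord_ge v 1 N" using scale[OF subfield_inverse[OF subfield_K K(2)] line] by simp
    \<comment> \<open>Completing the norm: the line is a norm equation \<open>s\<^sup>q\<^sup>+\<^sup>1 = e\<close> with \<open>e\<close> in the subfield of \<open>q\<close> elements.\<close>
    have "s ^ q = x ^ q - m" unfolding s_def frob_diff const_power_q2[OF mn(1)] ..
    then have sq: "s ^ (q + 1) = (x ^ q - m) * (x - m ^ q)" by (simp add: s_def)
    have Nq: "N ^ q + N = x ^ (q + 1) - m ^ q * x ^ q - m * x - (n ^ q + n)"
      unfolding curve_eq[symmetric] by (simp add: N_def frob_diff power_mult_distrib)
    have eq: "N ^ q + N = s ^ (q + 1) - e"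
      unfolding Nq sq by (simp add: e_def algebra_simps)
    have se: "ord_ge v 1 (s ^ (q + 1) - e)"
      unfolding eq[symmetric] using N q by (intro ord_ge_add[OF v] ord_ge_power[OF v]) auto
    have s: "ord_ge v 0 s" unfolding s_def using xy(1) ord_ge_const[OF v mq] by (intro ord_ge_diff[OF v])
    have s1: "ord_ge v 0 (s ^ q ^ 2 - s)"
      using s q by (intro ord_ge_diff[OF v] ord_ge_power[OF v]) auto
    \<comment> \<open>Modulo the place, \<open>s ^ (q + 1)\<close> is fixed by the
      \<open>q\<close>-th power. The difference factors, so either \<open>s\<close> vanishes there
      or it is fixed by the \<open>q ^ 2\<close>-th power; the first case is contained in the
      second.\<close>
    have "(s ^ (q + 1) - e) ^ q - (s ^ (q + 1) - e) = s ^ q * (s ^ q ^ 2 - s)"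
      by (simp add: frob_diff e power2_eq_square power_mult power_mult_distrib algebra_simps)
    moreover have "ord_ge v 1 ((s ^ (q + 1) - e) ^ q - (s ^ (q + 1) - e))"
      by (rule ord_ge_diff[OF v ord_ge_power[OF v se] se]) (use q in auto)
    ultimately have "ord_ge v 1 (s ^ q) \<or> ord_ge v 1 (s ^ q ^ 2 - s)"
      using s s1 q by (intro ord_ge_prime[OF v]) (auto intro: ord_ge_power[OF v])
    then have "ord_ge v 1 (s ^ q ^ 2 - s)"
    proof
      assume "ord_ge v 1 (s ^ q)"
      then have "ord_ge v 1 s" using s by (rule ord_ge_power_1[OF v, rotated])
      then show ?thesis using q by (intro ord_ge_diff[OF v] ord_ge_power[OF v]) auto
    qed
    then show thesis using that mq by (simp add: s_def)
  qed
  have shift: "(x - k) ^ q ^ 2 - (x - k) = x ^ q ^ 2 - x"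
    using finite_subfield_power_card[OF subfield_K finite_K k(1)]
    by (simp add: frobenius_diff card_K)
  have x2: "ord_ge v 1 (x ^ q ^ 2 - x)" using k(2) unfolding shift .
  \<comment> \<open>The curve equation minus its \<open>q\<close>-th power transfers the conclusion
    from \<open>x\<close> to \<open>y\<close>.\<close>
  have "(y ^ q + y) ^ q = (x ^ (q + 1)) ^ q" by (simp only: curve_eq)
  then have "y ^ q ^ 2 - y = (x ^ (q + 1)) ^ q - x ^ (q + 1)"
    unfolding curve_eq[symmetric] by (simp add: frob_add power2_eq_square power_mult)
  also have "\<dots> = x ^ q * (x ^ q ^ 2 - x)"
    by (simp add: power2_eq_square power_mult power_mult_distrib algebra_simps)
  finally have "y ^ q ^ 2 - y = x ^ q * (x ^ q ^ 2 - x)" .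
  moreover have "ord_ge v (0 + 1) (x ^ q * (x ^ q ^ 2 - x))"
    using xy x2 q by (intro ord_ge_mult[OF v] ord_ge_power[OF v]) auto
  ultimately have y2: "ord_ge v 1 (y ^ q ^ 2 - y)" by simp
  obtain \<alpha> where "\<alpha> \<in> K" "ord_ge v 1 (x - \<alpha>)" using rational_residue[OF v xy(1) x2] .
  moreover obtain \<beta> where "\<beta> \<in> K" "ord_ge v 1 (y - \<beta>)" using rational_residue[OF v xy(2) y2] .
  ultimately show thesis using that by blast
qed

section \<open>The divisor of a line and the discrepancy classes\<close>

context
  fixes P Q :: "'f \<Rightarrow> int" and a b c :: 'f and H :: "'f divisor"
  assumes P: "P \<in> rational_points K" and P_x: "P x < 0"
    and Q: "Q \<in> places K" and Q_x: "Q x > 0" and Q_y: "Q y > 0"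
    and K: "a \<in> K" "b \<in> K" "c \<in> K" and nz: "(a, b, c) \<noteq> (0, 0, 0)"
    and H: "H = line_divisor K x y a b c"
begin

lemmas PQ = P P_x Q Q_x Q_y

text \<open>The zeros outside infinity are rational and determined by their residues, so they inject
  into \<open>K \<times> K\<close>. A constant form has no zeros there.\<close>

lemma finite_line_zeros: "finite {v \<in> places K. v \<noteq> P \<and> 0 < v (a * x + b * y + c)}"
proof (cases "(a, b) = (0, 0)")
  case True
  then have "{v \<in> places K. v \<noteq> P \<and> 0 < v (a * x + b * y + c)} = {}"
    using place_const[OF _ K(3)] by force
  then show ?thesis by (simp only: finite.emptyI)
next
  case False
  define Z where "Z = {v \<in> places K. v \<noteq> P \<and> 0 < v (a * x + b * y + c)}"
  define lies_at where "lies_at = (\<lambda>v p. p \<in> K \<times> K \<and> ord_ge v 1 (x - fst p) \<and> ord_ge v 1 (y - snd p))"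
  have ZK: "v \<in> places K" if "v \<in> Z" for v using that by (simp add: Z_def)
  have "\<exists>p. lies_at v p" if vZ: "v \<in> Z" for v
  proof -
    have "v \<noteq> P" and line: "ord_ge v 1 (a * x + b * y + c)"
      using that by (auto simp: ord_ge_def Z_def)
    have xy: "ord_ge v 0 x" "ord_ge v 0 y"
      using finite_place_values[OF PQ ZK[OF that] \<open>v \<noteq> P\<close>] by (simp_all add: ord_ge_def)
    obtain \<alpha> \<beta> where "\<alpha> \<in> K" "\<beta> \<in> K" "ord_ge v 1 (x - \<alpha>)" "ord_ge v 1 (y - \<beta>)"
      by (rule line_zero_rational[OF ZK[OF vZ] xy K False line])
    then show ?thesis by (intro exI[of _ "(\<alpha>, \<beta>)"]) (simp add: lies_at_def)
  qed
  then obtain g where g: "\<forall>v\<in>Z. lies_at v (g v)" using bchoice[of Z lies_at] by blast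
  have "inj_on g Z"
  proof (rule inj_onI)
    fix v w assume vw: "v \<in> Z" "w \<in> Z" "g v = g w"
    have "lies_at v (g v)" "lies_at w (g v)" using g vw by auto
    then show "v = w"
      using ZK[OF vw(1)] ZK[OF vw(2)] unfolding lies_at_def
      by (intro rational_place_unique[of v "fst (g v)" "snd (g v)" w]) auto
  qed
  moreover have "g ` Z \<subseteq> K \<times> K" using g unfolding lies_at_def by blast
  ultimately have "finite Z" using finite_K by (meson finite_SigmaI finite_imageD finite_subset)
  then show ?thesis by (simp only: Z_def)
qed

text \<open>The local equation of the line is the linear form itself at finite places and the form
  divided by \<open>y\<close> at infinity, where \<open>y\<close> has the largest pole.\<close>

lemma H_eq: "H v = principal K (a * x + b * y + c) v + (int q + 1) * pt P v"
proof -
  have "Min {v x, v y, v 1} = - ((int q + 1) * pt P v)" if v: "v \<in> places K"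
    using finite_place_values[OF PQ v] values_infinity[OF v] P_x
    by (cases "v = P") (auto simp: place_one[OF v] place_one[OF rational_point_place[OF P]] pt_def min_def)
  then show ?thesis using rational_point_place[OF P] by (auto simp: H line_divisor_def principal_def pt_def)
qed

lemma H_divisor: "H \<in> divisors K"
proof -
  have "H v = 0" if "v \<notin> insert P {v \<in> places K. v \<noteq> P \<and> 0 < v (a * x + b * y + c)}" for v
  proof (cases "v \<in> places K")
    case v: True
    have "ord_ge v 0 x" "ord_ge v 0 y" using finite_place_values[OF PQ v] that by (auto simp: ord_ge_def)
    then have "ord_ge v 0 (a * x)" "ord_ge v 0 (b * y)"
      using ord_ge_mult[OF v ord_ge_const[OF v K(1)]] ord_ge_mult[OF v ord_ge_const[OF v K(2)]] by fastforce+
    then have "ord_ge v 0 (a * x + b * y + c)"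
      using ord_ge_add[OF v ord_ge_add[OF v] ord_ge_const[OF v K(3)]] by simp
    then have "0 \<le> v (a * x + b * y + c)" using line_nonzero[OF P P_x K nz] by (simp add: ord_ge_def)
    then show ?thesis using that v by (auto simp: H_eq principal_def pt_def)
  next
    case False
    then show ?thesis by (simp add: H line_divisor_def)
  qed
  then have "{v. H v \<noteq> 0} \<subseteq> insert P {v \<in> places K. v \<noteq> P \<and> 0 < v (a * x + b * y + c)}" by auto
  moreover have "{v. H v \<noteq> 0} \<subseteq> places K" by (auto simp: H line_divisor_def split: if_splits)
  ultimately show ?thesis
    unfolding divisors_def using finite_line_zeros finite_subset by blast
qed

abbreviation D :: "nat \<Rightarrow> 'f divisor" where
  "D d \<equiv> (\<lambda>v. int d * H v - int d * pt P v - int d * pt Q v)"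

abbreviation D' :: "nat \<Rightarrow> 'f divisor" where
  "D' d \<equiv> (\<lambda>v. int q * int d * pt P v + (- int d) * pt Q v)"

text \<open>The \<open>d\<close>-th power of the linear form replaces \<open>H\<close> by
  \<open>(q + 1) P\<close>, after which only P and Q occur.\<close>

lemma class_D: "divisor_class K (D d) = divisor_class K (D' d)"
proof -
  let ?N = "a * x + b * y + c"
  have "{v. D d v \<noteq> 0} \<subseteq> insert P (insert Q {v. H v \<noteq> 0})" by (auto simp: pt_def)
  then have "D d \<in> divisors K"
    using H_divisor Q rational_point_place[OF P] unfolding divisors_def
    by (auto intro: finite_subset)
  moreover have "D' d \<in> divisors K" by (rule pt_divisor[OF PQ])
  moreover have "D d v - D' d v = principal K (?N ^ d) v" for v
    using line_nonzero[OF P P_x K nz] unfolding H_eq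
    by (auto simp: principal_def place_power algebra_simps)
  moreover have "?N ^ d \<noteq> 0" using line_nonzero[OF P P_x K nz] by simp
  ultimately have "(D d, D' d) \<in> lin_equiv K" unfolding lin_equiv_def by blast
  then show ?thesis unfolding divisor_class_def using equiv_class_eq[OF equiv_lin_equiv] by blast
qed

lemma H_equiv_P: "(H, \<lambda>v. (int q + 1) * pt P v) \<in> lin_equiv K"
  using H_divisor pt_divisor[OF PQ, of "int q + 1" 0] line_nonzero[OF P P_x K nz] H_eq
  unfolding lin_equiv_def by auto

lemma H_equiv_Q: "(H, \<lambda>v. (int q + 1) * pt Q v) \<in> lin_equiv K"
proof -
  have "(\<lambda>v. (int q + 1) * pt P v, \<lambda>v. (int q + 1) * pt Q v) \<in> lin_equiv K"
    using lin_equiv_shift[OF PQ, of "int q + 1" 0 "-1"] by (simp add: add.commute)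
  then show ?thesis using H_equiv_P equiv_lin_equiv[of K] by (meson equivE transD)
qed

lemma discrepancies0_eq: "discrepancies0 K P Q = (\<lambda>d. divisor_class K (D' d)) ` {0..q}"
proof (intro equalityI subsetI)
  fix C assume "C \<in> discrepancies0 K P Q"
  then obtain A i j where A: "C = divisor_class K A" "A \<in> divisors K" "discrepancy K P Q A"
    and C: "C = divisor_class K (\<lambda>v. i * pt P v + j * pt Q v)"
    by (auto simp: discrepancies0_def discrepancies_def)
  have "divisor_class K A = divisor_class K (\<lambda>v. i * pt P v + j * pt Q v)" using A C by simp
  then have "(A, \<lambda>v. i * pt P v + j * pt Q v) \<in> lin_equiv K"
    by (rule iffD1[OF divisor_class_eq_iff[OF A(2) pt_divisor[OF PQ]]])
  then have "discrepancy K P Q (\<lambda>v. i * pt P v + j * pt Q v)" using discrepancy_lin_equiv A by blast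
  then obtain k l where kl: "0 \<le> k" "k \<le> int q" "i = int q * k + (int q + 1) * l" "j = - (k + (int q + 1) * l)"
    unfolding discrepancy_iff[OF PQ] by blast
  have ij: "i = int q * k + (int q + 1) * l" "j = - k - (int q + 1) * l" using kl by simp_all
  \<comment> \<open>The exponent \<open>l\<close> of the monomial is removed by the divisor of a
    power of \<open>y\<close>; the exponent \<open>k\<close> survives as the index
    \<open>d\<close>.\<close>
  have "(\<lambda>v. int q * k * pt P v + (- k) * pt Q v, \<lambda>v. i * pt P v + j * pt Q v) \<in> lin_equiv K"
    unfolding ij by (rule lin_equiv_shift[OF PQ])
  from iffD2[OF divisor_class_eq_iff[OF pt_divisor[OF PQ] pt_divisor[OF PQ]] this]
  have "C = divisor_class K (D' (nat k))" unfolding C using kl(1) by simp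
  then show "C \<in> (\<lambda>d. divisor_class K (D' d)) ` {0..q}" by (rule image_eqI) (use kl in simp)
next
  fix C assume "C \<in> (\<lambda>d. divisor_class K (D' d)) ` {0..q}"
  then obtain d where d: "d \<le> q" "C = divisor_class K (D' d)" by auto
  have "discrepancy K P Q (D' d)"
    unfolding discrepancy_iff[OF PQ] using d by (intro exI[of _ "int d"] exI[of _ 0]) auto
  moreover have "D' d \<in> divisors K" by (rule pt_divisor[OF PQ])
  ultimately show "C \<in> discrepancies0 K P Q"
    unfolding discrepancies0_def discrepancies_def d(2) by blast
qed

lemma inj_on_class_D': "inj_on (\<lambda>d. divisor_class K (D' d)) {0..q}"
proof (rule inj_onI)
  fix d e :: nat assume eq: "divisor_class K (D' d) = divisor_class K (D' e)"
  have "(D' d, D' e) \<in> lin_equiv K" "(D' e, D' d) \<in> lin_equiv K"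
    using iffD1[OF divisor_class_eq_iff[OF pt_divisor[OF PQ] pt_divisor[OF PQ]] eq]
      iffD1[OF divisor_class_eq_iff[OF pt_divisor[OF PQ] pt_divisor[OF PQ]] eq[symmetric]] .
  from this[THEN lin_equiv_imp_le[OF PQ]] have "int d \<le> int e" "int e \<le> int d" .
  then show "d = e" by simp
qed

lemma discrepancies_at_infinity_and_origin:
  "(H, \<lambda>v. (int q + 1) * pt P v) \<in> lin_equiv K
    \<and> (H, \<lambda>v. (int q + 1) * pt Q v) \<in> lin_equiv K
    \<and> discrepancies0 K P Q = (\<lambda>d. divisor_class K (D d)) ` {0..q}
    \<and> inj_on (\<lambda>d. divisor_class K (D d)) {0..q}
    \<and> card (discrepancies0 K P Q) = q + 1"
  using H_equiv_P H_equiv_Q discrepancies0_eq inj_on_class_D'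
  by (simp add: class_D card_image)

end

text \<open>If P is not already at infinity it is translated to the origin and inverted. Then Q is
  finite, since only one place lies at infinity, and the translation that moves it to the origin
  keeps P at infinity.\<close>

lemma coordinates_at_infinity_and_origin:
  assumes P: "P \<in> rational_points K" and Q: "Q \<in> rational_points K" and "P \<noteq> Q"
  obtains x' y' where "hermitian_curve q K x' y'" "same_lines K x y x' y'" "P x' < 0" "0 < Q x'" "0 < Q y'"
proof -
  note P' = rational_point_place[OF P] and Q' = rational_point_place[OF Q]
  obtain x1 y1 where 1: "hermitian_curve q K x1 y1" "same_lines K x y x1 y1" "P x1 < 0"
  proof (cases "P x < 0")
    case True
    then show thesis using that[of x y] same_lines_refl hermitian_curve_axioms by blast
  next
    case False
    then have "ord_ge P 0 x" "ord_ge P 0 y" using y_integral[OF P'] by (auto simp: ord_ge_def)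
    then obtain \<alpha> \<beta> where ab: "\<alpha> \<in> K" "ord_ge P 1 (x - \<alpha>)" "\<beta> \<in> K" "ord_ge P 1 (y - \<beta>)"
      using rational_point_residue[OF P subfield_K] by metis
    note T = move_to_origin[OF P' ab]
    note I = hermitian_curve.invert[OF T(1) P T(3,4)]
    show thesis using that[OF I(1) same_lines_trans[OF T(2) I(3)] I(2)] .
  qed
  interpret C: hermitian_curve q K x1 y1 by (rule 1(1))
  have Qx: "\<not> Q x1 < 0" using C.infinity_unique[OF P' 1(3) Q'] \<open>P \<noteq> Q\<close> by blast
  then have "ord_ge Q 0 x1" "ord_ge Q 0 y1" using C.y_integral[OF Q'] by (auto simp: ord_ge_def)
  then obtain \<alpha> \<beta> where ab: "\<alpha> \<in> K" "ord_ge Q 1 (x1 - \<alpha>)" "\<beta> \<in> K" "ord_ge Q 1 (y1 - \<beta>)"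
    using rational_point_residue[OF Q subfield_K] by metis
  note T = C.move_to_origin[OF Q' ab]
  have "P (x1 - \<alpha>) < 0"
  proof (rule ccontr)
    assume "\<not> P (x1 - \<alpha>) < 0"
    then have "ord_ge P 0 (x1 - \<alpha>)" by (simp add: ord_ge_def)
    then have "ord_ge P 0 (x1 - \<alpha> + \<alpha>)" using ord_ge_add[OF P' _ ord_ge_const[OF P' ab(1)]] by blast
    then show False using 1(3) C.x_neq_0 by (simp add: ord_ge_def)
  qed
  then show thesis using that[OF T(1) same_lines_trans[OF 1(2) T(2)] _ T(3,4)] by blast
qed

end

theorem proposition9p1:
  fixes q :: nat and K :: "'f::field set" and x y a b c :: 'f
    and P Q :: "'f \<Rightarrow> int" and H :: "'f divisor"
  assumes "hermitian_curve q K x y"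
    and "P \<in> rational_points K" and "Q \<in> rational_points K" and "P \<noteq> Q"
    and "a \<in> K" and "b \<in> K" and "c \<in> K" and "(a, b, c) \<noteq> (0, 0, 0)"
    and "H = line_divisor K x y a b c"
  shows "(H, \<lambda>v. (int q + 1) * pt P v) \<in> lin_equiv K
    \<and> (H, \<lambda>v. (int q + 1) * pt Q v) \<in> lin_equiv K
    \<and> discrepancies0 K P Q =
        (\<lambda>d. divisor_class K (\<lambda>v. int d * H v - int d * pt P v - int d * pt Q v)) ` {0..q}
    \<and> inj_on (\<lambda>d. divisor_class K (\<lambda>v. int d * H v - int d * pt P v - int d * pt Q v)) {0..q}
    \<and> card (discrepancies0 K P Q) = q + 1"
proof -
  obtain x' y' where C: "hermitian_curve q K x' y'" "same_lines K x y x' y'"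
    "P x' < 0" "0 < Q x'" "0 < Q y'"
    using hermitian_curve.coordinates_at_infinity_and_origin[OF assms(1-4)] .
  obtain a' b' c' where abc: "a' \<in> K" "b' \<in> K" "c' \<in> K" "(a', b', c') \<noteq> (0, 0, 0)"
    "H = line_divisor K x' y' a' b' c'"
    using C(2) assms(5-9) unfolding same_lines_def by metis
  show ?thesis
    using hermitian_curve.discrepancies_at_infinity_and_origin[OF C(1) assms(2) C(3)
        rational_point_place[OF assms(3)] C(4,5) abc] .
qed

end
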